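(* Let $\mathcal{H}$ be a separable Hilbert space, let $\mathcal{F}=\{f_n\}_{n\in\mathbb{N}}$ be a frame for a closed subspace $\mathcal{W}$ of $\mathcal{H}$ with synthesis operator $T:\ell^2\to\mathcal{H}$, let $\mathcal{M}$ be another closed subspace of $\mathcal{H}$ such that $\mathcal{H}=\mathcal{W}\dot{+}\mathcal{M}^\perp$, and let $\mathcal{G}=\{g_n\}_{n\in\mathbb{N}}$ be a fixed frame for $\mathcal{M}$ with synthesis operator $B:\ell^2\to\mathcal{H}$. Then the following conditions are equivalent: 1. $\mathcal{F}$ is a Riesz frame on $\mathcal{W}$. 2. $\displaystyle\sup_{D\in\mathcal{D}(\ell^2)}\|B(D^{-1/2}T^*B)^\dagger D^{-1/2}\|<\infty$.
   Context: A sequence (finite or countable) $\{f_n\}$ is a frame for a closed subspace $\mathcal{W}\subseteq\mathcal{H}$ if it lies in $\mathcal{W}$ and there are $A,B>0$ (bounds) with $A\|f\|^2\le\sum_n|\langle f,f_n\rangle|^2\le B\|f\|^2$ for all $f\in\mathcal{W}$. The synthesis operator of a frame $\{f_n\}_{n\in\mathbb{N}}$ is the bounded operator $\ell^2\to\mathcal{H}$ sending $e_n$ to $f_n$, where $\{e_n\}_{n\in\mathbb{N}}$ is the canonical orthonormal basis of $\ell^2$; its range is $\mathcal{W}$. A frame $\mathcal{F}=\{f_n\}_{n\in\mathbb{N}}$ for $\mathcal{W}$ is a Riesz frame on $\mathcal{W}$ if there exist $A,B>0$ such that for every $I\subset\mathbb{N}$ the family $\{f_n\}_{n\in I}$ is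 a frame for $\overline{\mathrm{span}}\{f_n:n\in I\}$ with (not necessarily optimal) bounds $A,B$. $\dot{+}$ denotes a direct (not necessarily orthogonal) sum; $^\dagger$ denotes the Moore-Penrose pseudoinverse of a closed range operator; $\mathcal{D}(\ell^2)$ is the set of all positive definite bounded invertible operators on $\ell^2$ that are diagonal in the canonical basis $\{e_n\}$. *)

theory Defs
  imports "HOL-Analysis.Analysis"
begin

section \<open>Scalars: the real or the complex field\<close>

text \<open>A complete field with a multiplicative norm and a conjugation satisfying
  \<open>x * cj x = \<bar>x\<bar>\<^sup>2\<close>. By the theorem of Gelfand and Mazur the only models are the real and
  the complex numbers with their usual conjugation, so that quantifying over this class means
  treating real and complex Hilbert spaces simultaneously.\<close>

class rc_scalar = real_normed_field + banach +
  fixes cj :: "'a \<Rightarrow> 'a"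
  assumes cj_add: "cj (x + y) = cj x + cj y"
    and cj_mult: "cj (x * y) = cj x * cj y"
    and mult_cj_scaleR: "x * cj x = (norm x)\<^sup>2 *\<^sub>R 1"

instantiation real :: rc_scalar
begin
definition cj_real :: "real \<Rightarrow> real" where "cj_real x = x"
instance by standard (auto simp: cj_real_def power2_eq_square)
end

instantiation complex :: rc_scalar
begin
definition cj_complex :: "complex \<Rightarrow> complex" where "cj_complex = cnj"
instance by standard (auto simp: cj_complex_def complex_mult_cnj cmod_power2 scaleR_conv_of_real)
end

lemma mult_cj: "x * cj x = of_real ((norm x)\<^sup>2)" for x :: "'a::rc_scalar"
  by (simp add: mult_cj_scaleR of_real_def)

lemma norm_cj [simp]: "norm (cj (x::'a::rc_scalar)) = norm x"
proof (cases "x = 0")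
  case True
  have "cj (0::'a) + cj 0 = cj 0" using cj_add[of "0::'a" 0] by simp
  then have "cj (0::'a) = 0" by (metis add_cancel_left_left)
  then show ?thesis using True by simp
next
  case False
  have "norm x * norm (cj x) = norm x * norm x"
    using arg_cong[OF mult_cj[of x], of norm] by (simp add: norm_mult power2_eq_square)
  then show ?thesis using False by simp
qed

lemma cj_0 [simp]: "cj (0::'a::rc_scalar) = 0"
  by (metis norm_cj norm_eq_zero)

lemma cj_cj [simp]: "cj (cj x) = (x::'a::rc_scalar)"
proof (cases "x = 0")
  case False
  then have "cj x \<noteq> 0" by (metis norm_cj norm_eq_zero)
  moreover have "cj x * cj (cj x) = cj x * x"
    using mult_cj[of x] mult_cj[of "cj x"] by (simp add: mult.commute)
  ultimately show ?thesis by simp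
qed simp

lemma bounded_linear_cj: "bounded_linear (cj :: 'a::rc_scalar \<Rightarrow> 'a)"
proof (rule bounded_linear_intro[where K = 1])
  fix r :: real and x :: 'a
  have "cj (of_real r :: 'a) = of_real r"
  proof (cases "r = 0")
    case False
    have "of_real r * cj (of_real r :: 'a) = of_real r * of_real r"
      using mult_cj[of "of_real r :: 'a"] by (simp add: power2_eq_square)
    then show ?thesis using False by simp
  qed simp
  then show "cj (r *\<^sub>R x) = r *\<^sub>R cj x" by (simp add: scaleR_conv_of_real cj_mult)
qed (auto simp: cj_add)

section \<open>Hilbert spaces over such a field\<close>

text \<open>Norm, topology and completeness come from the type; \<open>smul\<close> extends the real scalar
  multiplication to \<open>'k\<close>, and \<open>ip\<close> is linear in its first argument and induces the norm.\<close>

locale hilbert_space = vector_space smul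
  for smul :: "'k::rc_scalar \<Rightarrow> 'h::banach \<Rightarrow> 'h" +
  fixes ip :: "'h \<Rightarrow> 'h \<Rightarrow> 'k"
  assumes scale_of_real: "smul (of_real r) x = r *\<^sub>R x"
    and ip_add_left: "ip (x + y) z = ip x z + ip y z"
    and ip_scale_left: "ip (smul c x) z = c * ip x z"
    and ip_commute: "ip y x = cj (ip x y)"
    and ip_self: "ip x x = of_real ((norm x)\<^sup>2)"

definition orthogonal_complement :: "('h \<Rightarrow> 'h \<Rightarrow> 'k::rc_scalar) \<Rightarrow> 'h set \<Rightarrow> 'h set" where
  "orthogonal_complement ip M = {x. \<forall>y\<in>M. ip x y = 0}"

definition closed_subspace ::
    "('k::rc_scalar \<Rightarrow> 'h::real_normed_vector \<Rightarrow> 'h) \<Rightarrow> 'h set \<Rightarrow> bool" where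
  "closed_subspace smul W \<longleftrightarrow> module.subspace smul W \<and> closed W"

definition closed_span ::
    "('k::rc_scalar \<Rightarrow> 'h::real_normed_vector \<Rightarrow> 'h) \<Rightarrow> 'h set \<Rightarrow> 'h set" where
  "closed_span smul S = closure (module.span smul S)"

definition direct_sum_decomposition :: "'h::ab_group_add set \<Rightarrow> 'h set \<Rightarrow> bool" where
  "direct_sum_decomposition W N \<longleftrightarrow> (\<forall>x. \<exists>w\<in>W. \<exists>n\<in>N. x = w + n) \<and> W \<inter> N = {0}"

section \<open>Bounded operators\<close>

definition bounded_op :: "('k::rc_scalar \<Rightarrow> 'a::real_normed_vector \<Rightarrow> 'a) \<Rightarrow>
    ('k \<Rightarrow> 'b::real_normed_vector \<Rightarrow> 'b) \<Rightarrow> ('a \<Rightarrow> 'b) \<Rightarrow> bool" where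
  "bounded_op s1 s2 T \<longleftrightarrow> Vector_Spaces.linear s1 s2 T \<and> (\<exists>K. \<forall>x. norm (T x) \<le> norm x * K)"

definition bounded_invertible_op ::
    "('k::rc_scalar \<Rightarrow> 'a::real_normed_vector \<Rightarrow> 'a) \<Rightarrow> ('a \<Rightarrow> 'a) \<Rightarrow> bool" where
  "bounded_invertible_op s T \<longleftrightarrow>
     bounded_op s s T \<and> (\<exists>S. bounded_op s s S \<and> S \<circ> T = id \<and> T \<circ> S = id)"

text \<open>The adjoint of \<open>T\<close>, for the inner product \<open>ip1\<close> on its domain and \<open>ip2\<close> on its
  codomain.\<close>

definition adj :: "('a \<Rightarrow> 'a \<Rightarrow> 'k::rc_scalar) \<Rightarrow> ('b \<Rightarrow> 'b \<Rightarrow> 'k) \<Rightarrow> ('a \<Rightarrow> 'b) \<Rightarrow> ('b \<Rightarrow> 'a)" where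
  "adj ip1 ip2 T = (THE S. \<forall>x y. ip2 (T x) y = ip1 x (S y))"

definition self_adjoint :: "('a \<Rightarrow> 'a \<Rightarrow> 'k::rc_scalar) \<Rightarrow> ('a \<Rightarrow> 'a) \<Rightarrow> bool" where
  "self_adjoint ip T \<longleftrightarrow> (\<forall>x y. ip (T x) y = ip x (T y))"

definition positive_op :: "('a \<Rightarrow> 'a \<Rightarrow> 'k::rc_scalar) \<Rightarrow> ('a \<Rightarrow> 'a) \<Rightarrow> bool" where
  "positive_op ip T \<longleftrightarrow> self_adjoint ip T \<and> (\<forall>x. \<exists>r\<ge>0. ip (T x) x = of_real r)"

definition positive_definite_op ::
    "('a::zero \<Rightarrow> 'a \<Rightarrow> 'k::rc_scalar) \<Rightarrow> ('a \<Rightarrow> 'a) \<Rightarrow> bool" where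
  "positive_definite_op ip T \<longleftrightarrow>
     self_adjoint ip T \<and> (\<forall>x. x \<noteq> 0 \<longrightarrow> (\<exists>r>0. ip (T x) x = of_real r))"

definition sqrt_op :: "('k::rc_scalar \<Rightarrow> 'a::real_normed_vector \<Rightarrow> 'a) \<Rightarrow> ('a \<Rightarrow> 'a \<Rightarrow> 'k) \<Rightarrow>
    ('a \<Rightarrow> 'a) \<Rightarrow> ('a \<Rightarrow> 'a)" where
  "sqrt_op s ip T = (THE S. bounded_op s s S \<and> positive_op ip S \<and> S \<circ> S = T)"

text \<open>The Moore-Penrose pseudoinverse, characterised by the four Penrose equations; it exists
  exactly when the bounded operator \<open>T\<close> has closed range.\<close>

definition pinv :: "('k::rc_scalar \<Rightarrow> 'a::real_normed_vector \<Rightarrow> 'a) \<Rightarrow> ('a \<Rightarrow> 'a \<Rightarrow> 'k) \<Rightarrow>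
    ('k \<Rightarrow> 'b::real_normed_vector \<Rightarrow> 'b) \<Rightarrow> ('b \<Rightarrow> 'b \<Rightarrow> 'k) \<Rightarrow> ('a \<Rightarrow> 'b) \<Rightarrow> ('b \<Rightarrow> 'a)" where
  "pinv s1 ip1 s2 ip2 T = (THE S. bounded_op s2 s1 S \<and> T \<circ> S \<circ> T = T \<and> S \<circ> T \<circ> S = S \<and>
     self_adjoint ip2 (T \<circ> S) \<and> self_adjoint ip1 (S \<circ> T))"

section \<open>The space of square-summable sequences\<close>

typedef (overloaded) 'k ell2 = "{x :: nat \<Rightarrow> 'k::rc_scalar. summable (\<lambda>n. (norm (x n))\<^sup>2)}"
  morphisms ell2_nth Abs_ell2
  by (rule exI[of _ "\<lambda>_. 0"]) simp

setup_lifting type_definition_ell2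

lemma ell2_eqI: "(\<And>n. ell2_nth x n = ell2_nth y n) \<Longrightarrow> x = y"
  by (metis ell2_nth_inject ext)

lemma ell2_summable: "summable (\<lambda>n. (norm (ell2_nth x n))\<^sup>2)"
  using ell2_nth by auto

lemma ell2_add_closed:
  fixes x y :: "nat \<Rightarrow> 'k::rc_scalar"
  assumes "summable (\<lambda>n. (norm (x n))\<^sup>2)" and "summable (\<lambda>n. (norm (y n))\<^sup>2)"
  shows "summable (\<lambda>n. (norm (x n + y n))\<^sup>2)"
proof (rule summable_comparison_test')
  show "summable (\<lambda>n. 2 * (norm (x n))\<^sup>2 + 2 * (norm (y n))\<^sup>2)"
    using assms by (intro summable_add summable_mult)
next
  fix n
  have "(norm (x n + y n))\<^sup>2 \<le> (norm (x n) + norm (y n))\<^sup>2"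
    by (simp add: norm_triangle_ineq power_mono)
  also have "\<dots> \<le> 2 * (norm (x n))\<^sup>2 + 2 * (norm (y n))\<^sup>2"
    using zero_le_power2[of "norm (x n) - norm (y n)"]
    by (simp add: power2_eq_square algebra_simps)
  finally show "norm ((norm (x n + y n))\<^sup>2) \<le> 2 * (norm (x n))\<^sup>2 + 2 * (norm (y n))\<^sup>2"
    by simp
qed

lift_definition scale_ell2 :: "'k::rc_scalar \<Rightarrow> 'k ell2 \<Rightarrow> 'k ell2" is "\<lambda>c x n. c * x n"
  by (auto simp: norm_mult power_mult_distrib intro: summable_mult)

instantiation ell2 :: (rc_scalar) ab_group_add
begin
lift_definition zero_ell2 :: "'a ell2" is "\<lambda>_. 0" by simp
lift_definition plus_ell2 :: "'a ell2 \<Rightarrow> 'a ell2 \<Rightarrow> 'a ell2" is "\<lambda>x y n. x n + y n"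
  by (auto intro: ell2_add_closed)
lift_definition uminus_ell2 :: "'a ell2 \<Rightarrow> 'a ell2" is "\<lambda>x n. - x n" by simp
lift_definition minus_ell2 :: "'a ell2 \<Rightarrow> 'a ell2 \<Rightarrow> 'a ell2" is "\<lambda>x y n. x n - y n"
  using ell2_add_closed[of _ "\<lambda>n. - _ n"] by auto
instance by standard (transfer; auto simp: fun_eq_iff)+
end

lemma ell2_triangle:
  fixes x y :: "nat \<Rightarrow> 'k::rc_scalar"
  assumes x: "summable (\<lambda>n. (norm (x n))\<^sup>2)" and y: "summable (\<lambda>n. (norm (y n))\<^sup>2)"
  shows "sqrt (\<Sum>n. (norm (x n + y n))\<^sup>2) \<le> sqrt (\<Sum>n. (norm (x n))\<^sup>2) + sqrt (\<Sum>n. (norm (y n))\<^sup>2)"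
    (is "sqrt ?s \<le> ?r")
proof -
  have r: "?r \<ge> 0" using x y by (simp add: suminf_nonneg)
  have "?s \<le> ?r\<^sup>2"
  proof (rule suminf_le_const[OF ell2_add_closed[OF x y]])
    fix N
    have "sqrt (\<Sum>n<N. (norm (x n + y n))\<^sup>2) \<le> L2_set (\<lambda>n. norm (x n) + norm (y n)) {..<N}"
      unfolding L2_set_def
      by (intro real_sqrt_le_mono sum_mono power_mono norm_triangle_ineq) simp
    also have "\<dots> \<le> L2_set (\<lambda>n. norm (x n)) {..<N} + L2_set (\<lambda>n. norm (y n)) {..<N}"
      by (rule L2_set_triangle_ineq)
    also have "\<dots> \<le> ?r"
      unfolding L2_set_def using x y
      by (intro add_mono real_sqrt_le_mono sum_le_suminf) auto
    finally show "(\<Sum>n<N. (norm (x n + y n))\<^sup>2) \<le> ?r\<^sup>2"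
      by (rule sqrt_le_D)
  qed
  then show ?thesis using r by (metis real_sqrt_le_mono real_sqrt_unique)
qed

instantiation ell2 :: (rc_scalar) real_normed_vector
begin
definition scaleR_ell2 :: "real \<Rightarrow> 'a ell2 \<Rightarrow> 'a ell2" where
  "scaleR_ell2 r x = scale_ell2 (of_real r) x"
definition norm_ell2 :: "'a ell2 \<Rightarrow> real" where
  "norm_ell2 x = sqrt (\<Sum>n. (norm (ell2_nth x n))\<^sup>2)"
definition dist_ell2 :: "'a ell2 \<Rightarrow> 'a ell2 \<Rightarrow> real" where
  "dist_ell2 x y = norm (x - y)"
definition sgn_ell2 :: "'a ell2 \<Rightarrow> 'a ell2" where
  "sgn_ell2 x = inverse (norm x) *\<^sub>R x"
definition uniformity_ell2 :: "('a ell2 \<times> 'a ell2) filter" where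
  "uniformity_ell2 = (INF e\<in>{0<..}. principal {(x, y). dist x y < e})"
definition open_ell2 :: "'a ell2 set \<Rightarrow> bool" where
  "open_ell2 U = (\<forall>x\<in>U. eventually (\<lambda>(x', y). x' = x \<longrightarrow> y \<in> U) uniformity)"
instance
proof
  fix x y :: "'a ell2" and a b :: real
  show "a *\<^sub>R (x + y) = a *\<^sub>R x + a *\<^sub>R y" "(a + b) *\<^sub>R x = a *\<^sub>R x + b *\<^sub>R x"
    "a *\<^sub>R b *\<^sub>R x = (a * b) *\<^sub>R x" "1 *\<^sub>R x = x"
    unfolding scaleR_ell2_def by (transfer; simp add: algebra_simps)+
  show "norm (x + y) \<le> norm x + norm y"
    unfolding norm_ell2_def plus_ell2.rep_eq
    by (rule ell2_triangle[OF ell2_summable ell2_summable])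
  show "norm (a *\<^sub>R x) = \<bar>a\<bar> * norm x"
    unfolding norm_ell2_def scaleR_ell2_def scale_ell2.rep_eq
    using suminf_mult[OF ell2_summable[of x], of "a\<^sup>2"]
    by (simp add: norm_mult power_mult_distrib real_sqrt_mult)
  show "norm x = 0 \<longleftrightarrow> x = 0"
    unfolding norm_ell2_def using suminf_eq_zero_iff[OF ell2_summable[of x]]
    by (auto simp: zero_ell2.rep_eq intro: ell2_eqI)
qed (simp_all add: dist_ell2_def sgn_ell2_def uniformity_ell2_def open_ell2_def)
end

lemma norm_ell2_nth_le: "norm (ell2_nth x n) \<le> norm x"
proof -
  have "(\<Sum>i\<in>{n}. (norm (ell2_nth x i))\<^sup>2) \<le> (\<Sum>i. (norm (ell2_nth x i))\<^sup>2)"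
    by (rule sum_le_suminf[OF ell2_summable]) auto
  then show ?thesis unfolding norm_ell2_def by (simp add: real_le_rsqrt)
qed

instance ell2 :: (rc_scalar) banach
proof
  fix X :: "nat \<Rightarrow> 'a ell2"
  assume X: "Cauchy X"
  have "Cauchy (\<lambda>m. ell2_nth (X m) n)" for n
  proof (rule CauchyI)
    fix e :: real assume "0 < e"
    then obtain N where N: "\<And>i j. i \<ge> N \<Longrightarrow> j \<ge> N \<Longrightarrow> norm (X i - X j) < e"
      using CauchyD[OF X] by blast
    have "norm (ell2_nth (X i) n - ell2_nth (X j) n) < e" if "i \<ge> N" "j \<ge> N" for i j
      using N[OF that] norm_ell2_nth_le[of "X i - X j" n] by (simp add: minus_ell2.rep_eq)
    then show "\<exists>M. \<forall>i\<ge>M. \<forall>j\<ge>M. norm (ell2_nth (X i) n - ell2_nth (X j) n) < e" by blast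
  qed
  then have "\<forall>n. \<exists>l. (\<lambda>m. ell2_nth (X m) n) \<longlonglongrightarrow> l"
    by (simp add: Cauchy_convergent_iff convergent_def)
  then obtain L where L: "\<And>n. (\<lambda>m. ell2_nth (X m) n) \<longlonglongrightarrow> L n" by metis
  have part: "\<exists>N. \<forall>m\<ge>N. \<forall>K. (\<Sum>i<K. (norm (ell2_nth (X m) i - L i))\<^sup>2) \<le> e\<^sup>2" if e: "0 < e" for e
  proof -
    obtain N where N: "\<And>i j. i \<ge> N \<Longrightarrow> j \<ge> N \<Longrightarrow> norm (X i - X j) < e"
      using CauchyD[OF X e] by blast
    have "(\<Sum>i<K. (norm (ell2_nth (X m) i - L i))\<^sup>2) \<le> e\<^sup>2" if "m \<ge> N" for m K
    proof (rule LIMSEQ_le_const2)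
      show "(\<lambda>k. \<Sum>i<K. (norm (ell2_nth (X m) i - ell2_nth (X k) i))\<^sup>2)
          \<longlonglongrightarrow> (\<Sum>i<K. (norm (ell2_nth (X m) i - L i))\<^sup>2)"
        by (intro tendsto_intros L)
      have "(\<Sum>i<K. (norm (ell2_nth (X m) i - ell2_nth (X k) i))\<^sup>2) \<le> e\<^sup>2" if "k \<ge> N" for k
      proof -
        have "(\<Sum>i<K. (norm (ell2_nth (X m - X k) i))\<^sup>2) \<le> (\<Sum>i. (norm (ell2_nth (X m - X k) i))\<^sup>2)"
          by (rule sum_le_suminf[OF ell2_summable]) auto
        also have "\<dots> = (norm (X m - X k))\<^sup>2"
          by (simp add: norm_ell2_def suminf_nonneg[OF ell2_summable])
        also have "\<dots> \<le> e\<^sup>2" using N[OF \<open>m \<ge> N\<close> that] by (simp add: power_mono)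
        finally show ?thesis by (simp add: minus_ell2.rep_eq)
      qed
      then show "\<exists>N. \<forall>k\<ge>N. (\<Sum>i<K. (norm (ell2_nth (X m) i - ell2_nth (X k) i))\<^sup>2) \<le> e\<^sup>2"
        by blast
    qed
    then show ?thesis by blast
  qed
  have summ: "summable (\<lambda>i. (norm (z i))\<^sup>2)" if "\<forall>K. (\<Sum>i<K. (norm (z i))\<^sup>2) \<le> c" for c and z :: "nat \<Rightarrow> 'a"
    using that by (intro bounded_imp_summable[where B = c]) (auto simp: lessThan_Suc_atMost[symmetric] simp del: sum.lessThan_Suc)
  obtain N1 where N1: "\<forall>K. (\<Sum>i<K. (norm (ell2_nth (X N1) i - L i))\<^sup>2) \<le> 1\<^sup>2"
    using part[of 1] by auto
  have "summable (\<lambda>i. (norm (ell2_nth (X N1) i - L i))\<^sup>2)"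
    by (rule summ[OF N1])
  then have "summable (\<lambda>i. (norm (ell2_nth (X N1) i + - (ell2_nth (X N1) i - L i)))\<^sup>2)"
    by (intro ell2_add_closed ell2_summable) (simp only: norm_minus_cancel)
  then have "summable (\<lambda>i. (norm (L i))\<^sup>2)" by simp
  then have nth: "ell2_nth (Abs_ell2 L) = L" by (simp add: Abs_ell2_inverse)
  have "X \<longlonglongrightarrow> Abs_ell2 L"
  proof (rule LIMSEQ_I)
    fix e :: real assume "0 < e"
    then obtain N where N: "\<And>m K. m \<ge> N \<Longrightarrow> (\<Sum>i<K. (norm (ell2_nth (X m) i - L i))\<^sup>2) \<le> (e/2)\<^sup>2"
      using part[of "e/2"] by auto
    have "norm (X m - Abs_ell2 L) < e" if "m \<ge> N" for m
    proof -
      have "(\<Sum>i. (norm (ell2_nth (X m) i - L i))\<^sup>2) \<le> (e/2)\<^sup>2"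
        using N[OF that] by (intro suminf_le_const summ) auto
      then have "norm (X m - Abs_ell2 L) \<le> e/2"
        unfolding norm_ell2_def minus_ell2.rep_eq nth using \<open>0 < e\<close> by (intro real_le_lsqrt) auto
      then show ?thesis using \<open>0 < e\<close> by simp
    qed
    then show "\<exists>N. \<forall>m\<ge>N. norm (X m - Abs_ell2 L) < e" by blast
  qed
  then show "convergent X" by (auto simp: convergent_def)
qed

definition ip_ell2 :: "'k::rc_scalar ell2 \<Rightarrow> 'k ell2 \<Rightarrow> 'k" where
  "ip_ell2 x y = (\<Sum>n. ell2_nth x n * cj (ell2_nth y n))"

lemma ip_ell2_summable: "summable (\<lambda>n. ell2_nth x n * cj (ell2_nth y n))"
proof (rule summable_comparison_test'[where N = 0])
  show "summable (\<lambda>n. (norm (ell2_nth x n))\<^sup>2 + (norm (ell2_nth y n))\<^sup>2)"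
    by (intro summable_add ell2_summable)
  fix n
  have "2 * (norm (ell2_nth x n) * norm (ell2_nth y n)) \<le> (norm (ell2_nth x n))\<^sup>2 + (norm (ell2_nth y n))\<^sup>2"
    using sum_squares_bound[of "norm (ell2_nth x n)" "norm (ell2_nth y n)"] by (simp add: algebra_simps)
  moreover have "0 \<le> norm (ell2_nth x n) * norm (ell2_nth y n)" by simp
  ultimately show "norm (ell2_nth x n * cj (ell2_nth y n)) \<le> (norm (ell2_nth x n))\<^sup>2 + (norm (ell2_nth y n))\<^sup>2"
    unfolding norm_mult norm_cj by linarith
qed

lemma hilbert_space_ell2: "hilbert_space scale_ell2 (ip_ell2 :: 'k::rc_scalar ell2 \<Rightarrow> _)"
proof
  fix a b c :: 'k and r :: real and x y z :: "'k ell2"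
  show "scale_ell2 a (x + y) = scale_ell2 a x + scale_ell2 a y"
    "scale_ell2 (a + b) x = scale_ell2 a x + scale_ell2 b x"
    "scale_ell2 a (scale_ell2 b x) = scale_ell2 (a * b) x" "scale_ell2 1 x = x"
    by (transfer; simp add: algebra_simps)+
  show "scale_ell2 (of_real r) x = r *\<^sub>R x" by (simp add: scaleR_ell2_def)
  show "ip_ell2 (x + y) z = ip_ell2 x z + ip_ell2 y z"
    unfolding ip_ell2_def plus_ell2.rep_eq
    by (simp add: distrib_right suminf_add[OF ip_ell2_summable ip_ell2_summable])
  show "ip_ell2 (scale_ell2 c x) z = c * ip_ell2 x z"
    unfolding ip_ell2_def scale_ell2.rep_eq
    by (simp add: mult.assoc suminf_mult[OF ip_ell2_summable])
  show "ip_ell2 y x = cj (ip_ell2 x y)"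
    unfolding ip_ell2_def
    by (simp add: bounded_linear.suminf[OF bounded_linear_cj ip_ell2_summable] cj_mult mult.commute)
  show "ip_ell2 x x = of_real ((norm x)\<^sup>2)"
    unfolding ip_ell2_def norm_ell2_def
    by (simp add: mult_cj suminf_nonneg[OF ell2_summable] suminf_of_real[OF ell2_summable]
        flip: of_real_power)
qed

lift_definition ell2_basis :: "nat \<Rightarrow> 'k::rc_scalar ell2" is "\<lambda>n k. if k = n then 1 else 0"
  subgoal for n by (rule summable_finite[where N = "{n}"]) auto
  done

definition diag_pos_ops :: "('k::rc_scalar ell2 \<Rightarrow> 'k ell2) set" where
  "diag_pos_ops = {D. bounded_invertible_op scale_ell2 D \<and> positive_definite_op ip_ell2 D \<and>
     (\<forall>n. \<exists>d. D (ell2_basis n) = scale_ell2 d (ell2_basis n))}"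

definition inv_sqrt_ell2 :: "('k::rc_scalar ell2 \<Rightarrow> 'k ell2) \<Rightarrow> 'k ell2 \<Rightarrow> 'k ell2" where
  "inv_sqrt_ell2 D = inv (sqrt_op scale_ell2 ip_ell2 D)"

section \<open>Frames\<close>

text \<open>Summability is demanded explicitly because an infinite sum defaults to \<open>0\<close> when it
  does not converge.\<close>

definition frame_with_bounds :: "('h::real_normed_vector \<Rightarrow> 'h \<Rightarrow> 'k::rc_scalar) \<Rightarrow>
    nat set \<Rightarrow> (nat \<Rightarrow> 'h) \<Rightarrow> 'h set \<Rightarrow> real \<Rightarrow> real \<Rightarrow> bool" where
  "frame_with_bounds ip I f W a b \<longleftrightarrow> f ` I \<subseteq> W \<and> 0 < a \<and> 0 < b \<and>
     (\<forall>x\<in>W. (\<lambda>n. (norm (ip x (f n)))\<^sup>2) summable_on I \<and>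
        a * (norm x)\<^sup>2 \<le> (\<Sum>\<^sub>\<infinity>n\<in>I. (norm (ip x (f n)))\<^sup>2) \<and>
        (\<Sum>\<^sub>\<infinity>n\<in>I. (norm (ip x (f n)))\<^sup>2) \<le> b * (norm x)\<^sup>2)"

definition frame :: "('h::real_normed_vector \<Rightarrow> 'h \<Rightarrow> 'k::rc_scalar) \<Rightarrow>
    nat set \<Rightarrow> (nat \<Rightarrow> 'h) \<Rightarrow> 'h set \<Rightarrow> bool" where
  "frame ip I f W \<longleftrightarrow> (\<exists>a b. frame_with_bounds ip I f W a b)"

definition riesz_frame :: "('k::rc_scalar \<Rightarrow> 'h::real_normed_vector \<Rightarrow> 'h) \<Rightarrow> ('h \<Rightarrow> 'h \<Rightarrow> 'k) \<Rightarrow>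
    (nat \<Rightarrow> 'h) \<Rightarrow> 'h set \<Rightarrow> bool" where
  "riesz_frame smul ip f W \<longleftrightarrow> frame ip UNIV f W \<and>
     (\<exists>a>0. \<exists>b>0. \<forall>I. frame_with_bounds ip I f (closed_span smul (f ` I)) a b)"

definition synthesis_operator :: "('k::rc_scalar \<Rightarrow> 'h::real_normed_vector \<Rightarrow> 'h) \<Rightarrow>
    (nat \<Rightarrow> 'h) \<Rightarrow> ('k ell2 \<Rightarrow> 'h) \<Rightarrow> bool" where
  "synthesis_operator smul f T \<longleftrightarrow>
     bounded_op scale_ell2 smul T \<and> (\<forall>n. T (ell2_basis n) = f n)"

end

theory Submission
  imports Defs
begin

text \<open>
  Write \<open>T*\<close> for the analysis operator, with components \<open>\<langle>y, f n\<rangle>\<close>, and \<open>R\<close> for the inverse square root of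
  a diagonal operator with entries \<open>d n\<close>. The vector \<open>y = B (R T* B)\<^sup>\<dagger> R x\<close> is the element of
  \<open>M\<close> whose frame coefficients \<open>T* y\<close> are closest to \<open>x\<close> in the \<open>\<ell>\<^sup>2\<close> norm with weights \<open>1 / d n\<close>
  (\<open>oblique_weighted_pinv_normal_equation\<close>, \<open>oblique_weighted_pinv_minimal\<close>). Because \<open>W\<close> and the complement of
  \<open>M\<close> are in direct sum, passing from \<open>y\<close> in \<open>M\<close> to its orthogonal projection to \<open>W\<close> keeps \<open>T* y\<close> and
  changes the norm at most by a fixed factor (\<open>oblique_projection_bound\<close>, by uniform boundedness). So the second
  condition says that weighted least squares solutions are bounded by the data, uniformly in the
  weights.

  A uniform bound yields a Riesz frame: with weight \<open>1\<close> on \<open>I\<close> and weights tending to \<open>0\<close> off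
  \<open>I\<close>, the solutions for the coefficients of \<open>x\<close> on \<open>I\<close> approximate \<open>x\<close> as far as the \<open>f n\<close> with \<open>n\<close> in
  \<open>I\<close> can see, so for \<open>x\<close> in their closed span the bound passes to \<open>x\<close>
  (\<open>riesz_frame_if_uniformly_bounded\<close>).

  Conversely, for finitely many vectors a weighted least squares solution is a convex combination of
  basic solutions, which solve exactly the equations of a subfamily within its span
  (\<open>least_squares_in_convex_hull_of_basic_solutions\<close>). The reason is that the solution moves on a segment when a
  single weight varies from \<open>0\<close> to infinity, and the two ends belong to problems in which that equation
  is dropped or imposed. The lower Riesz bound for the subfamily bounds each basic solution by the
  data, with a constant depending neither on the weights nor on the number of vectors. Truncation
  to the first \<open>N\<close> vectors and a weak limit then give the general case
  (\<open>uniformly_bounded_if_riesz_frame\<close>).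
\<close>

section \<open>Geometry of Hilbert spaces\<close>

context hilbert_space
begin

lemma ip_zero_left [simp]: "ip 0 z = 0"
  using ip_add_left[of 0 0 z] by simp

lemma ip_zero_right [simp]: "ip z 0 = 0"
  by (metis ip_commute ip_zero_left cj_0)

lemma ip_add_right: "ip z (x + y) = ip z x + ip z y"
  by (metis ip_commute ip_add_left cj_add)

lemma ip_scale_right: "ip z (smul c x) = cj c * ip z x"
  by (metis ip_commute ip_scale_left cj_mult)

lemma ip_minus_left: "ip (- x) z = - ip x z"
  using ip_add_left[of x "- x" z] by (simp add: eq_neg_iff_add_eq_0 add.commute)

lemma ip_minus_right: "ip z (- x) = - ip z x"
  using ip_add_right[of z x "- x"] by (simp add: eq_neg_iff_add_eq_0 add.commute)

lemma ip_diff_left: "ip (x - y) z = ip x z - ip y z"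
  using ip_add_left[of x "- y" z] by (simp add: ip_minus_left)

lemma ip_diff_right: "ip z (x - y) = ip z x - ip z y"
  using ip_add_right[of z x "- y"] by (simp add: ip_minus_right)

lemma ip_sum_left: "ip (sum h A) z = (\<Sum>i\<in>A. ip (h i) z)"
  by (induction A rule: infinite_finite_induct) (auto simp: ip_add_left)

lemma ip_sum_right: "ip z (sum h A) = (\<Sum>i\<in>A. ip z (h i))"
  by (induction A rule: infinite_finite_induct) (auto simp: ip_add_right)

lemma ip_scaleR_left: "ip (r *\<^sub>R x) z = of_real r * ip x z"
  by (metis scale_of_real ip_scale_left)

lemma cj_of_real: "cj (of_real r :: 'k) = of_real r"
  using linear_simps(5)[OF bounded_linear_cj, of r "1::'k"] mult_cj[of "1::'k"]
  by (simp add: scaleR_conv_of_real)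

lemma ip_scaleR_right: "ip z (r *\<^sub>R x) = of_real r * ip z x"
  by (metis scale_of_real ip_scale_right cj_of_real)

lemma norm_ip_self: "norm (ip x x) = (norm x)\<^sup>2"
  by (simp add: ip_self norm_power)

lemma ip_self_eq_0_iff [simp]: "ip x x = 0 \<longleftrightarrow> x = 0"
  by (simp add: ip_self)

lemma norm_ip_commute: "norm (ip x y) = norm (ip y x)"
  by (metis ip_commute norm_cj)

lemma ip_eq_0_commute: "ip x y = 0 \<longleftrightarrow> ip y x = 0"
  by (metis norm_ip_commute norm_eq_zero)

lemma ip_ext: "(\<And>z. ip z x = ip z y) \<Longrightarrow> x = y"
  using ip_self_eq_0_iff[of "x - y"] by (simp add: ip_diff_right)

lemma norm_smul: "norm (smul c x) = norm c * norm x"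
proof -
  have "ip (smul c x) (smul c x) = (c * cj c) * ip x x"
    by (simp add: ip_scale_left ip_scale_right)
  then have "norm (ip (smul c x) (smul c x)) = norm c * norm c * norm (ip x x)"
    by (simp add: norm_mult)
  then have "(norm (smul c x))\<^sup>2 = (norm c * norm x)\<^sup>2"
    by (simp add: norm_ip_self power2_eq_square)
  then show ?thesis by (simp add: power2_eq_iff_nonneg)
qed

lemma pythagoras:
  assumes "ip x y = 0"
  shows "(norm (x + y))\<^sup>2 = (norm x)\<^sup>2 + (norm y)\<^sup>2"
proof -
  have "ip y x = 0" using assms ip_eq_0_commute by blast
  then have "of_real ((norm (x + y))\<^sup>2) = (of_real ((norm x)\<^sup>2 + (norm y)\<^sup>2) :: 'k)"
    using assms by (simp add: ip_add_left ip_add_right flip: ip_self of_real_power)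
  then show ?thesis using of_real_eq_iff by blast
qed

text \<open>Removing from \<open>x\<close> its component along \<open>y\<close> shortens it by exactly that component. The
  Cauchy-Schwarz inequality and the orthogonality of the closest point both come from here.\<close>

lemma norm_subtract_component:
  assumes "y \<noteq> 0"
  shows "(norm (x - smul (ip x y / of_real ((norm y)\<^sup>2)) y))\<^sup>2
    = (norm x)\<^sup>2 - (norm (ip x y))\<^sup>2 / (norm y)\<^sup>2"
proof -
  let ?c = "ip x y / of_real ((norm y)\<^sup>2)"
  have "ip (x - smul ?c y) (smul ?c y) = 0"
    using assms by (simp add: ip_diff_left ip_scale_left ip_scale_right ip_self)
  from pythagoras[OF this]
  have "(norm x)\<^sup>2 = (norm (x - smul ?c y))\<^sup>2 + (norm ?c * norm y)\<^sup>2"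
    by (simp add: norm_smul)
  moreover have "norm ?c * norm y = norm (ip x y) / norm y"
    using assms by (simp add: norm_divide norm_mult power2_eq_square)
  ultimately show ?thesis by (simp add: power_divide)
qed

lemma cauchy_schwarz: "norm (ip x y) \<le> norm x * norm y"
proof (cases "y = 0")
  case False
  have "0 \<le> (norm x)\<^sup>2 - (norm (ip x y))\<^sup>2 / (norm y)\<^sup>2"
    by (metis False norm_subtract_component zero_le_power2)
  then have "(norm (ip x y))\<^sup>2 \<le> (norm x * norm y)\<^sup>2"
    using False by (simp add: divide_simps power_mult_distrib)
  then show ?thesis by (rule power2_le_imp_le) simp
qed simp

lemma bounded_bilinear_ip: "bounded_bilinear ip"
proof
  show "\<exists>K. \<forall>a b. norm (ip a b) \<le> norm a * norm b * K"
    using cauchy_schwarz by (intro exI[of _ 1]) simp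
qed (simp_all add: ip_add_left ip_add_right ip_scaleR_left ip_scaleR_right scaleR_conv_of_real)

lemmas tendsto_ip = bounded_bilinear.tendsto[OF bounded_bilinear_ip]
lemmas continuous_on_ip = bounded_bilinear.continuous_on[OF bounded_bilinear_ip]

lemma parallelogram:
  fixes x y :: 'h
  shows
  "(norm (x + y))\<^sup>2 + (norm (x - y))\<^sup>2 = 2 * (norm x)\<^sup>2 + 2 * (norm y)\<^sup>2"
proof -
  have "ip (x + y) (x + y) + ip (x - y) (x - y) = 2 * ip x x + 2 * ip y y"
    by (simp add: ip_add_left ip_add_right ip_diff_left ip_diff_right algebra_simps)
  then have "of_real ((norm (x + y))\<^sup>2 + (norm (x - y))\<^sup>2) = (of_real (2 * (norm x)\<^sup>2 + 2 * (norm y)\<^sup>2) :: 'k)"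
    unfolding ip_self by (simp only: of_real_add of_real_mult of_real_numeral)
  then show ?thesis using of_real_eq_iff by blast
qed

lemma bounded_linear_smul: "bounded_linear (smul c)"
  by (rule bounded_linear_intro[where K = "norm c"])
    (auto simp: scale_right_distrib norm_smul scale_of_real[symmetric] mult.commute)

lemma subspace_scaleR: "subspace U \<Longrightarrow> x \<in> U \<Longrightarrow> r *\<^sub>R x \<in> U"
  by (metis scale_of_real subspace_scale)

lemma closed_subspace_closure:
  assumes "subspace U" shows "closed_subspace smul (closure U)"
proof -
  have "subspace (closure U)"
  proof (rule subspaceI)
    show "0 \<in> closure U" using subspace_0[OF assms] closure_subset by blast
  next
    fix x y assume "x \<in> closure U" "y \<in> closure U"
    then obtain a b where "\<And>n. a n \<in> U" "a \<longlonglongrightarrow> x" "\<And>n. b n \<in> U" "b \<longlonglongrightarrow> y"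
      unfolding closure_sequential by metis
    then show "x + y \<in> closure U"
      unfolding closure_sequential
      by (intro exI[of _ "\<lambda>n. a n + b n"] conjI allI subspace_add[OF assms] tendsto_add)
  next
    fix c x assume "x \<in> closure U"
    then obtain a where "\<And>n. a n \<in> U" "a \<longlonglongrightarrow> x"
      unfolding closure_sequential by metis
    then show "smul c x \<in> closure U"
      unfolding closure_sequential
      by (intro exI[of _ "\<lambda>n. smul c (a n)"] conjI allI subspace_scale[OF assms]
          bounded_linear.tendsto[OF bounded_linear_smul]) auto
  qed
  then show ?thesis by (simp add: closed_subspace_def)
qed

text \<open>By the parallelogram law, two points of a convex set that are almost closest to \<open>x\<close> are close to
  each other, since their midpoint is not closer than the distance; so a minimizing sequence is
  Cauchy.\<close>

lemma closest_point_exists: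
  assumes U: "closed_subspace smul U"
  shows "\<exists>p\<in>U. \<forall>u\<in>U. norm (x - p) \<le> norm (x - u)"
proof -
  have sub: "subspace U" and cl: "closed U" using U by (auto simp: closed_subspace_def)
  define d where "d = (INF u\<in>U. norm (x - u))"
  have ne: "U \<noteq> {}" using subspace_0[OF sub] by blast
  have bdd: "bdd_below ((\<lambda>u. norm (x - u)) ` U)" by (rule bdd_belowI2[of _ 0]) simp
  have d_le: "d \<le> norm (x - u)" if "u \<in> U" for u
    unfolding d_def by (rule cINF_lower[OF bdd that])
  have d0: "0 \<le> d" unfolding d_def using ne by (intro cINF_greatest) auto
  have "\<exists>u\<in>U. norm (x - u) < d + 1 / real (Suc n)" for n
    using cInf_lessD[of "(\<lambda>u. norm (x - u)) ` U" "d + 1 / real (Suc n)"] ne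
    by (auto simp: d_def)
  then obtain u where u: "\<And>n. u n \<in> U" "\<And>n. norm (x - u n) < d + 1 / real (Suc n)" by metis
  have lim: "(\<lambda>n. norm (x - u n)) \<longlonglongrightarrow> d"
  proof (rule tendsto_sandwich[of "\<lambda>_. d" _ _ "\<lambda>n. d + 1 / real (Suc n)"])
    show "(\<lambda>n. d + 1 / real (Suc n)) \<longlonglongrightarrow> d"
      using tendsto_add[OF tendsto_const[of d] LIMSEQ_inverse_real_of_nat] by (simp add: inverse_eq_divide)
    show "\<forall>\<^sub>F n in sequentially. norm (x - u n) \<le> d + 1 / real (Suc n)"
      using u(2) less_imp_le by (intro always_eventually) blast
    show "\<forall>\<^sub>F n in sequentially. d \<le> norm (x - u n)"
      using d_le u(1) by (intro always_eventually) blast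
  qed (rule tendsto_const)
  have par: "(norm (u m - u n))\<^sup>2 \<le> 2 * (norm (x - u m))\<^sup>2 + 2 * (norm (x - u n))\<^sup>2 - 4 * d\<^sup>2" for m n
  proof -
    have "(1/2) *\<^sub>R (u m + u n) \<in> U"
      using u sub by (intro subspace_scaleR subspace_add) auto
    from d_le[OF this] have "d \<le> norm ((1/2) *\<^sub>R ((x - u m) + (x - u n)))"
      by (simp add: algebra_simps flip: scaleR_left.add)
    then have "2 * d \<le> norm ((x - u m) + (x - u n))" by simp
    then have "(2 * d)\<^sup>2 \<le> (norm ((x - u m) + (x - u n)))\<^sup>2" using d0 by (intro power_mono) auto
    moreover have "(norm ((x - u m) - (x - u n))) = norm (u m - u n)"
      by (simp add: norm_minus_commute)
    ultimately show ?thesis using parallelogram[of "x - u m" "x - u n"] by (simp add: power2_eq_square)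
  qed
  have "Cauchy u"
  proof (rule CauchyI)
    fix e :: real assume e: "0 < e"
    have "(\<lambda>n. (norm (x - u n))\<^sup>2) \<longlonglongrightarrow> d\<^sup>2" by (intro tendsto_intros lim)
    then have "eventually (\<lambda>n. (norm (x - u n))\<^sup>2 < d\<^sup>2 + e\<^sup>2 / 4) sequentially"
      by (rule order_tendstoD) (use e in simp)
    then obtain N where N: "\<And>n. n \<ge> N \<Longrightarrow> (norm (x - u n))\<^sup>2 < d\<^sup>2 + e\<^sup>2 / 4"
      unfolding eventually_sequentially by blast
    have "norm (u m - u n) < e" if "m \<ge> N" "n \<ge> N" for m n
    proof -
      have "(norm (u m - u n))\<^sup>2 < e\<^sup>2" using par[of m n] N[OF that(1)] N[OF that(2)] by linarith
      then show ?thesis using e by (auto intro: power_less_imp_less_base)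
    qed
    then show "\<exists>M. \<forall>m\<ge>M. \<forall>n\<ge>M. norm (u m - u n) < e" by blast
  qed
  then obtain p where p: "u \<longlonglongrightarrow> p" using Cauchy_convergent_iff convergent_def by blast
  have "p \<in> U" using cl p u(1) closed_sequentially by blast
  moreover have "norm (x - p) = d"
    using LIMSEQ_unique[OF lim tendsto_norm[OF tendsto_diff[OF tendsto_const p]]] by simp
  ultimately show ?thesis using d_le by blast
qed

text \<open>If the residual \<open>x - p\<close> at the closest point \<open>p\<close> had a component along some \<open>u\<close> in the subspace,
  removing that component would lead to a closer point.\<close>

theorem orthogonal_projection_exists:
  assumes U: "closed_subspace smul U"
  shows "\<exists>p\<in>U. \<forall>u\<in>U. ip (x - p) u = 0"
proof -
  have sub: "subspace U" using U by (simp add: closed_subspace_def)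
  obtain p where p: "p \<in> U" "\<And>u. u \<in> U \<Longrightarrow> norm (x - p) \<le> norm (x - u)"
    using closest_point_exists[OF U] by blast
  have "ip (x - p) u = 0" if u: "u \<in> U" for u
  proof (cases "u = 0")
    case False
    define c where "c = ip (x - p) u / of_real ((norm u)\<^sup>2)"
    have "p + smul c u \<in> U" using p(1) u sub by (intro subspace_add subspace_scale)
    then have "(norm (x - p))\<^sup>2 \<le> (norm (x - p - smul c u))\<^sup>2"
      using p(2) by (intro power_mono) (auto simp: diff_diff_eq)
    then have "(norm (ip (x - p) u))\<^sup>2 / (norm u)\<^sup>2 \<le> 0"
      using norm_subtract_component[OF False, of "x - p"] unfolding c_def by linarith
    then show ?thesis using False by (simp add: divide_le_0_iff)
  qed simp
  then show ?thesis using p(1) by blast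
qed

text \<open>The residual of the projection of a vector of \<open>W\<close> to the closure of \<open>U\<close> lies in \<open>W\<close> and is
  orthogonal to \<open>U\<close>.\<close>

lemma dense_if_no_orthogonal_vector:
  assumes "subspace U" "closed_subspace smul W" "U \<subseteq> W"
    and none: "\<And>q. q \<in> W \<Longrightarrow> (\<And>u. u \<in> U \<Longrightarrow> ip q u = 0) \<Longrightarrow> q = 0"
  shows "W \<subseteq> closure U"
proof
  fix y assume y: "y \<in> W"
  have sW: "subspace W" and cW: "closed W" using assms by (auto simp: closed_subspace_def)
  obtain p where p: "p \<in> closure U" "\<And>u. u \<in> closure U \<Longrightarrow> ip (y - p) u = 0"
    using orthogonal_projection_exists[OF closed_subspace_closure[OF assms(1)], of y] by blast
  have "p \<in> W" using p(1) closure_minimal[OF assms(3) cW] by blast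
  then have "y - p \<in> W" using sW y subspace_diff by blast
  then have "y - p = 0" using none p(2) closure_subset by blast
  then show "y \<in> closure U" using p(1) by simp
qed

text \<open>The uniform boundedness principle. The space is the union over \<open>k\<close> of the closed sets of all \<open>h\<close>
  for which the bound \<open>k\<close> works, so by Baire's theorem one of them contains a ball; the difference
  of two points of that ball can be taken parallel to any given \<open>y\<close> in \<open>Y\<close>.\<close>

theorem weakly_bounded_imp_bounded:
  assumes weak: "\<And>h. \<exists>c. \<forall>y\<in>Y. norm (ip y h) \<le> c"
  shows "\<exists>c. \<forall>y\<in>Y. norm y \<le> c"
proof -
  define L where "L k = {h. \<forall>y\<in>Y. norm (ip y h) \<le> real k}" for k
  have "\<exists>k. interior (L k) \<noteq> {}"
  proof (rule ccontr)
    assume "\<nexists>k. interior (L k) \<noteq> {}"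
    moreover have "closed (L k)" for k
    proof -
      have "L k = (\<Inter>y\<in>Y. {h. norm (ip y h) \<le> real k})" by (auto simp: L_def)
      moreover have "closed {h. norm (ip y h) \<le> real k}" for y
        by (intro closed_Collect_le continuous_on_norm continuous_on_ip continuous_on_const continuous_on_id)
      ultimately show ?thesis by auto
    qed
    ultimately have "euclidean interior_of (\<Union>(range L)) = {}"
      by (intro Baire_category_alt disjI1 completely_metrizable_space_euclidean) auto
    moreover have "\<Union>(range L) = UNIV"
    proof -
      have "\<exists>k. h \<in> L k" for h
      proof -
        obtain c where "\<forall>y\<in>Y. norm (ip y h) \<le> c" using weak by blast
        moreover obtain k where "c \<le> real k" using real_arch_simple by blast
        ultimately have "h \<in> L k" unfolding L_def using order_trans by blast
        then show ?thesis by blast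
      qed
      then show ?thesis by blast
    qed
    ultimately show False by simp
  qed
  then obtain k h where "h \<in> interior (L k)" by blast
  then obtain r where r: "r > 0" "cball h r \<subseteq> L k"
    by (meson interior_subset mem_interior_cball)
  have "norm y \<le> 2 * real k / r" if y: "y \<in> Y" for y
  proof (cases "y = 0")
    case False
    define v where "v = (r / norm y) *\<^sub>R y"
    have "norm v = r" using False r by (simp add: v_def)
    then have "h + v \<in> L k" "h \<in> L k" using r by (auto simp: dist_norm)
    then have "norm (ip y (h + v)) \<le> real k" "norm (ip y h) \<le> real k" using y by (auto simp: L_def)
    moreover have "ip y v = ip y (h + v) - ip y h" by (simp add: ip_add_right)
    ultimately have "norm (ip y v) \<le> 2 * real k" by (smt (verit) norm_triangle_ineq4)
    moreover have "norm (ip y v) = r * norm y"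
      using False r by (simp add: v_def ip_scaleR_right norm_mult norm_ip_self power2_eq_square norm_divide)
    ultimately show ?thesis using r by (simp add: field_simps)
  qed (use r in simp)
  then show ?thesis by blast
qed

text \<open>The kernel of a nonzero functional has a one-dimensional orthogonal complement, spanned by the
  residual \<open>q\<close> of a vector outside the kernel; the representing vector is a multiple of \<open>q\<close>.\<close>

theorem riesz_representation:
  assumes add: "\<And>x y. \<phi> (x + y) = \<phi> x + \<phi> y" and scale: "\<And>c x. \<phi> (smul c x) = c * \<phi> x"
    and bound: "\<And>x. norm (\<phi> x) \<le> norm x * K"
  shows "\<exists>z. \<forall>x. \<phi> x = ip x z"
proof (cases "\<forall>x. \<phi> x = 0")
  case False
  then obtain x0 where x0: "\<phi> x0 \<noteq> 0" by blast
  have bl: "bounded_linear \<phi>"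
    by (rule bounded_linear_intro[where K = K])
      (use add scale bound in \<open>auto simp: scale_of_real[symmetric] scaleR_conv_of_real\<close>)
  have zero: "\<phi> 0 = 0" using add[of 0 0] by simp
  have diff: "\<phi> (x - y) = \<phi> x - \<phi> y" for x y by (rule linear_simps(2)[OF bl])
  have ker: "closed_subspace smul {x. \<phi> x = 0}"
    unfolding closed_subspace_def
  proof
    show "subspace {x. \<phi> x = 0}" by (rule subspaceI) (simp_all add: add scale zero)
    show "closed {x. \<phi> x = 0}"
      by (intro closed_Collect_eq bounded_linear.continuous_on[OF bl] continuous_on_id continuous_on_const)
  qed
  obtain p where "p \<in> {x. \<phi> x = 0}" "\<And>u. u \<in> {x. \<phi> x = 0} \<Longrightarrow> ip (x0 - p) u = 0"
    using orthogonal_projection_exists[OF ker, of x0] by blast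
  then have p: "\<phi> p = 0" "\<And>u. \<phi> u = 0 \<Longrightarrow> ip (x0 - p) u = 0" by simp_all
  define q where "q = x0 - p"
  have q: "\<phi> q \<noteq> 0" using x0 p(1) by (simp add: q_def diff)
  then have q0: "q \<noteq> 0" using zero by auto
  have "\<phi> x = ip x (smul (cj (\<phi> q / of_real ((norm q)\<^sup>2))) q)" for x
  proof -
    have "\<phi> (smul (\<phi> q) x - smul (\<phi> x) q) = 0" by (simp add: diff scale)
    then have "ip q (smul (\<phi> q) x - smul (\<phi> x) q) = 0" using p(2) by (simp add: q_def)
    then have "ip (smul (\<phi> q) x - smul (\<phi> x) q) q = 0" using ip_eq_0_commute by blast
    then have "\<phi> q * ip x q = \<phi> x * of_real ((norm q)\<^sup>2)"
      by (simp add: ip_diff_left ip_scale_left ip_self)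
    then show ?thesis using q0 by (simp add: ip_scale_right field_simps)
  qed
  then show ?thesis by blast
qed (auto intro!: exI[of _ 0])

end

section \<open>Adjoints and pseudoinverses\<close>

lemma bounded_op_add: "bounded_op s1 s2 T \<Longrightarrow> T (x + y) = T x + T y"
  by (simp add: bounded_op_def Vector_Spaces.linear_iff)

lemma bounded_op_scale: "bounded_op s1 s2 T \<Longrightarrow> T (s1 c x) = s2 c (T x)"
  by (simp add: bounded_op_def Vector_Spaces.linear_iff)

lemma bounded_op_bound:
  assumes "bounded_op s1 s2 T"
  obtains K where "K > 0" "\<And>x. norm (T x) \<le> K * norm x"
proof -
  obtain K where K: "\<And>x. norm (T x) \<le> norm x * K" using assms by (auto simp: bounded_op_def)
  have "norm (T x) \<le> (\<bar>K\<bar> + 1) * norm x" for x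
    using order_trans[OF K[of x] mult_left_mono[of K "\<bar>K\<bar> + 1" "norm x"]] by (simp add: mult.commute)
  then show ?thesis using that[of "\<bar>K\<bar> + 1"] by simp
qed

lemma bounded_op_compose:
  assumes "bounded_op s1 s2 T" "bounded_op s2 s3 U"
  shows "bounded_op s1 s3 (U \<circ> T)"
proof -
  obtain K where K: "K > 0" "\<And>x. norm (T x) \<le> K * norm x" using bounded_op_bound[OF assms(1)] by blast
  obtain L where L: "L > 0" "\<And>x. norm (U x) \<le> L * norm x" using bounded_op_bound[OF assms(2)] by blast
  have "norm (U (T x)) \<le> norm x * (L * K)" for x
    using order_trans[OF L(2)[of "T x"] mult_left_mono[OF K(2)[of x], of L]] L(1)
    by (simp add: algebra_simps)
  moreover have "Vector_Spaces.linear s1 s3 (U \<circ> T)"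
    using assms by (auto simp: bounded_op_def Vector_Spaces.linear_iff)
  ultimately show ?thesis by (auto simp: bounded_op_def)
qed

locale hilbert_pair = X: hilbert_space s1 ip1 + Y: hilbert_space s2 ip2
  for s1 :: "'k::rc_scalar \<Rightarrow> 'a::banach \<Rightarrow> 'a" and ip1
    and s2 :: "'k \<Rightarrow> 'b::banach \<Rightarrow> 'b" and ip2
begin

lemma bounded_opI:
  assumes "\<And>x y. T (x + y) = T x + T y" "\<And>c x. T (s1 c x) = s2 c (T x)"
    and "\<And>x. norm (T x) \<le> K * norm x"
  shows "bounded_op s1 s2 T"
  using assms X.vector_space_axioms Y.vector_space_axioms
  by (auto simp: bounded_op_def Vector_Spaces.linear_iff mult.commute intro!: exI[of _ K])

lemma bounded_op_bounded_linear:
  assumes "bounded_op s1 s2 T" shows "bounded_linear T"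
proof -
  obtain K where K: "\<And>x. norm (T x) \<le> K * norm x" using bounded_op_bound[OF assms] by blast
  show ?thesis
    by (rule bounded_linear_intro[where K = K])
      (use K bounded_op_add[OF assms] bounded_op_scale[OF assms, of "of_real _"] in
        \<open>auto simp: X.scale_of_real Y.scale_of_real mult.commute\<close>)
qed

lemma adj_exists:
  assumes T: "bounded_op s1 s2 T"
  shows "\<exists>S. \<forall>x y. ip2 (T x) y = ip1 x (S y)"
proof -
  obtain K where K: "K > 0" "\<And>x. norm (T x) \<le> K * norm x" using bounded_op_bound[OF T] by blast
  have "\<exists>z. \<forall>x. ip2 (T x) y = ip1 x z" for y
  proof (rule X.riesz_representation[where K = "K * norm y"])
    fix x show "norm (ip2 (T x) y) \<le> norm x * (K * norm y)"
      using Y.cauchy_schwarz[of "T x" y] mult_right_mono[OF K(2)[of x], of "norm y"]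
      by (simp add: algebra_simps)
  qed (simp_all add: bounded_op_add[OF T] bounded_op_scale[OF T] Y.ip_add_left Y.ip_scale_left)
  then show ?thesis by metis
qed

lemma adj_eq:
  assumes T: "bounded_op s1 s2 T"
  shows "ip2 (T x) y = ip1 x (adj ip1 ip2 T y)"
proof -
  have "\<exists>!S. \<forall>x y. ip2 (T x) y = ip1 x (S y)"
  proof (rule ex_ex1I[OF adj_exists[OF T]])
    fix S S' assume "\<forall>x y. ip2 (T x) y = ip1 x (S y)" "\<forall>x y. ip2 (T x) y = ip1 x (S' y)"
    then have "S y = S' y" for y by (intro X.ip_ext) metis
    then show "S = S'" by blast
  qed
  from theI'[OF this] show ?thesis unfolding adj_def by blast
qed

lemma adj_bounded_op:
  assumes T: "bounded_op s1 s2 T"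
  shows "bounded_op s2 s1 (adj ip1 ip2 T)"
proof -
  interpret swap: hilbert_pair s2 ip2 s1 ip1 ..
  obtain K where K: "K > 0" "\<And>x. norm (T x) \<le> K * norm x" using bounded_op_bound[OF T] by blast
  show ?thesis
  proof (rule swap.bounded_opI[where K = K])
    fix x y c
    show "adj ip1 ip2 T (x + y) = adj ip1 ip2 T x + adj ip1 ip2 T y"
      by (rule X.ip_ext) (simp add: adj_eq[OF T, symmetric] X.ip_add_right Y.ip_add_right)
    show "adj ip1 ip2 T (s2 c x) = s1 c (adj ip1 ip2 T x)"
      by (rule X.ip_ext) (simp add: adj_eq[OF T, symmetric] X.ip_scale_right Y.ip_scale_right)
    let ?z = "adj ip1 ip2 T x"
    have "(norm ?z)\<^sup>2 = norm (ip2 (T ?z) x)" by (simp add: adj_eq[OF T] X.norm_ip_self)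
    also have "\<dots> \<le> norm (T ?z) * norm x" by (rule Y.cauchy_schwarz)
    also have "\<dots> \<le> K * norm ?z * norm x" by (intro mult_right_mono K) auto
    finally have "norm ?z * norm ?z \<le> norm ?z * (K * norm x)" by (simp add: power2_eq_square algebra_simps)
    then show "norm ?z \<le> K * norm x"
      using K(1) by (cases "?z = 0") auto
  qed
qed

lemma adj_eq_right:
  assumes T: "bounded_op s1 s2 T"
  shows "ip2 y (T x) = ip1 (adj ip1 ip2 T y) x"
  by (metis adj_eq[OF T] X.ip_commute Y.ip_commute)

lemma kernel_closed_subspace:
  assumes C: "bounded_op s1 s2 C"
  shows "closed_subspace s1 {z. C z = 0}"
  unfolding closed_subspace_def
proof
  note bl = bounded_op_bounded_linear[OF C]
  show "X.subspace {z. C z = 0}"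
    by (rule X.subspaceI) (simp_all add: bounded_op_add[OF C] bounded_op_scale[OF C] linear_simps(3)[OF bl])
  show "closed {z. C z = 0}"
    by (intro closed_Collect_eq bounded_linear.continuous_on[OF bl] continuous_on_id continuous_on_const)
qed

lemma range_subspace:
  assumes C: "bounded_op s1 s2 C"
  shows "Y.subspace (range C)"
proof (rule Y.subspaceI)
  show "0 \<in> range C" using linear_simps(3)[OF bounded_op_bounded_linear[OF C]] by (metis rangeI)
qed (auto simp: bounded_op_add[OF C, symmetric] bounded_op_scale[OF C, symmetric])

text \<open>If \<open>S\<close> and \<open>S'\<close> both satisfy the Penrose equations for \<open>C\<close>, then \<open>C \<circ> S\<close> and \<open>C \<circ> S'\<close> are orthogonal
  projections with the same range, that of \<open>C\<close>, while \<open>S \<circ> C\<close> and \<open>S' \<circ> C\<close> are orthogonal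
  projections with the same kernel, that of \<open>C\<close>.\<close>

lemma penrose_unique:
  assumes C: "bounded_op s1 s2 C"
    and S: "C \<circ> S \<circ> C = C" "S \<circ> C \<circ> S = S" "self_adjoint ip2 (C \<circ> S)" "self_adjoint ip1 (S \<circ> C)"
    and S': "C \<circ> S' \<circ> C = C" "S' \<circ> C \<circ> S' = S'" "self_adjoint ip2 (C \<circ> S')" "self_adjoint ip1 (S' \<circ> C)"
  shows "S = S'"
proof -
  have e: "C (S (C x)) = C x" "S (C (S y)) = S y" "C (S' (C x)) = C x" "S' (C (S' y)) = S' y" for x y
    using S(1,2) S'(1,2) by (metis comp_apply)+
  have a: "ip2 (C (S x)) y = ip2 x (C (S y))" "ip2 (C (S' x)) y = ip2 x (C (S' y))" for x y
    using S(3) S'(3) by (simp_all add: self_adjoint_def)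
  have b: "ip1 (S (C x)) y = ip1 x (S (C y))" "ip1 (S' (C x)) y = ip1 x (S' (C y))" for x y
    using S(4) S'(4) by (simp_all add: self_adjoint_def)
  have CS: "C (S y) = C (S' y)" for y
  proof (rule Y.ip_ext)
    fix z show "ip2 z (C (S y)) = ip2 z (C (S' y))" by (metis a e(1,3))
  qed
  have SC: "S (C x) = S' (C x)" for x
  proof (rule X.ip_ext)
    fix z show "ip1 z (S (C x)) = ip1 z (S' (C x))" by (metis b e(1,3))
  qed
  show ?thesis by (metis CS SC e ext)
qed

text \<open>The lower bound on the complement \<open>Np\<close> of the kernel makes the range closed, because preimages in
  \<open>Np\<close> of a Cauchy sequence form a Cauchy sequence. The pseudoinverse maps \<open>y\<close> to the only point of
  \<open>Np\<close> whose image is the orthogonal projection of \<open>y\<close> to the range. Linearity, the bound and the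
  Penrose equations all follow from the uniqueness of a point of \<open>Np\<close> with residual orthogonal to
  the range.\<close>

lemma pinv_exists:
  assumes C: "bounded_op s1 s2 C" and c: "0 < c"
    and low: "\<And>x. x \<in> orthogonal_complement ip1 {z. C z = 0} \<Longrightarrow> c * norm x \<le> norm (C x)"
  shows "\<exists>S. bounded_op s2 s1 S \<and> C \<circ> S \<circ> C = C \<and> S \<circ> C \<circ> S = S \<and>
     self_adjoint ip2 (C \<circ> S) \<and> self_adjoint ip1 (S \<circ> C)"
proof -
  define N where "N = {z. C z = 0}"
  define Np where "Np = orthogonal_complement ip1 N"
  note bl = bounded_op_bounded_linear[OF C]
  note C_diff = linear_simps(2)[OF bl]
  have Np: "x \<in> Np \<longleftrightarrow> (\<forall>z. C z = 0 \<longrightarrow> ip1 x z = 0)" for x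
    by (auto simp: Np_def N_def orthogonal_complement_def)
  have low': "c * norm x \<le> norm (C x)" if "x \<in> Np" for x using low that by (simp add: Np_def N_def)
  have Np_diff: "x - y \<in> Np" if "x \<in> Np" "y \<in> Np" for x y using that by (simp add: Np X.ip_diff_left)
  have inj: "x = y" if "x \<in> Np" "y \<in> Np" "C x = C y" for x y
    using low'[OF Np_diff[OF that(1,2)]] that(3) c by (simp add: C_diff mult_le_0_iff)
  have Np_rep: "\<exists>x\<in>Np. C x = C v" for v
  proof -
    obtain p where "p \<in> N" "\<And>u. u \<in> N \<Longrightarrow> ip1 (v - p) u = 0"
      using X.orthogonal_projection_exists[OF kernel_closed_subspace[OF C], of v] by (auto simp: N_def)
    then have "v - p \<in> Np" "C (v - p) = C v" by (auto simp: Np N_def C_diff)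
    then show ?thesis by blast
  qed
  have closed_range: "closure (range C) \<subseteq> C ` Np"
  proof
    fix p assume "p \<in> closure (range C)"
    then obtain y where y: "\<And>n. y n \<in> range C" "y \<longlonglongrightarrow> p" unfolding closure_sequential by blast
    have "\<exists>x\<in>Np. C x = y n" for n using y(1)[of n] Np_rep by auto
    then obtain x where x: "\<And>n. x n \<in> Np" "\<And>n. C (x n) = y n" by metis
    have "Cauchy x"
    proof (rule CauchyI)
      fix e :: real assume "0 < e"
      then have "0 < c * e" using c by simp
      then obtain M where M: "\<And>m n. m \<ge> M \<Longrightarrow> n \<ge> M \<Longrightarrow> norm (y m - y n) < c * e"
        using CauchyD[OF LIMSEQ_imp_Cauchy[OF y(2)]] by blast
      have "norm (x m - x n) < e" if "m \<ge> M" "n \<ge> M" for m n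
      proof -
        have "c * norm (x m - x n) < c * e"
          using low'[OF Np_diff[OF x(1) x(1)], of m n] M[OF that] by (simp add: C_diff x(2))
        then show ?thesis using c by simp
      qed
      then show "\<exists>M. \<forall>m\<ge>M. \<forall>n\<ge>M. norm (x m - x n) < e" by blast
    qed
    then obtain x0 where x0: "x \<longlonglongrightarrow> x0" using Cauchy_convergent_iff convergent_def by blast
    have "x0 \<in> Np"
    proof -
      have "ip1 x0 z = 0" if "C z = 0" for z
      proof -
        have "(\<lambda>n. ip1 (x n) z) \<longlonglongrightarrow> ip1 x0 z" by (intro X.tendsto_ip x0 tendsto_const)
        moreover have "ip1 (x n) z = 0" for n using x(1) that Np by blast
        ultimately show ?thesis by (simp add: LIMSEQ_const_iff)
      qed
      then show ?thesis by (simp add: Np)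
    qed
    moreover have "C x0 = p"
      using LIMSEQ_unique[OF bounded_linear.tendsto[OF bl x0]] y(2) by (simp add: x(2))
    ultimately show "p \<in> C ` Np" by blast
  qed
  have "\<exists>x\<in>Np. \<forall>z. ip2 (y - C x) (C z) = 0" for y
  proof -
    obtain p where p: "p \<in> closure (range C)" "\<And>u. u \<in> closure (range C) \<Longrightarrow> ip2 (y - p) u = 0"
      using Y.orthogonal_projection_exists[OF Y.closed_subspace_closure[OF range_subspace[OF C]], of y]
      by blast
    then obtain x where "x \<in> Np" "C x = p" using closed_range by blast
    then show ?thesis using p(2) closure_subset by blast
  qed
  then obtain S where S: "\<And>y. S y \<in> Np" "\<And>y z. ip2 (y - C (S y)) (C z) = 0" by metis
  have S_unique: "S y = x" if "x \<in> Np" "\<And>z. ip2 (y - C x) (C z) = 0" for x y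
  proof -
    have "ip2 (C (S y - x)) (C (S y - x)) = 0"
      using that(2)[of "S y - x"] S(2)[of y "S y - x"] unfolding C_diff[of "S y" x]
      by (simp add: Y.ip_diff_left)
    then show ?thesis using inj[OF S(1)[of y] that(1)] by (simp add: C_diff)
  qed
  have CSC: "C (S (C v)) = C v" for v
    using Np_rep[of v] S_unique by (metis Y.ip_zero_left diff_self)
  have ip_CS: "ip2 (C (S y)) (C z) = ip2 y (C z)" for y z
    using S(2)[of y z] by (simp add: Y.ip_diff_left)
  have ip_CS': "ip2 (C z) (C (S y)) = ip2 (C z) y" for y z
    using ip_CS[of y z] by (metis Y.ip_commute)
  have "bounded_op s2 s1 S"
  proof (rule hilbert_pair.bounded_opI[where K = "1 / c"])
    show "hilbert_pair s2 ip2 s1 ip1" ..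
    fix x y a
    show "S (x + y) = S x + S y"
      using S(1)[of x] S(1)[of y] by (intro S_unique)
       (auto simp: Np X.ip_add_left bounded_op_add[OF C] Y.ip_diff_left Y.ip_add_left ip_CS)
    show "S (s2 a x) = s1 a (S x)"
      using S(1)[of x] by (intro S_unique)
        (auto simp: Np X.ip_scale_left bounded_op_scale[OF C] Y.ip_diff_left Y.ip_scale_left ip_CS)
    have "(norm (C (S y)))\<^sup>2 = norm (ip2 y (C (S y)))" by (simp add: ip_CS flip: Y.norm_ip_self)
    also have "\<dots> \<le> norm y * norm (C (S y))" by (rule Y.cauchy_schwarz)
    finally have "norm (C (S y)) \<le> norm y" by (cases "C (S y) = 0") (auto simp: power2_eq_square)
    then show "norm (S y) \<le> 1 / c * norm y"
      using low'[OF S(1)[of y]] c by (simp add: field_simps)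
  qed
  moreover have "C \<circ> S \<circ> C = C" using CSC by auto
  moreover have "S \<circ> C \<circ> S = S"
    using S_unique[OF S(1)] by (auto simp: fun_eq_iff)
  moreover have "self_adjoint ip2 (C \<circ> S)"
    unfolding self_adjoint_def comp_def using ip_CS ip_CS' by metis
  moreover have "self_adjoint ip1 (S \<circ> C)"
  proof -
    have "ip1 x (v - S (C v)) = 0" if "x \<in> Np" for x v
    proof -
      have "C (v - S (C v)) = 0" by (simp only: C_diff CSC diff_self)
      then show ?thesis using that Np by blast
    qed
    then have *: "ip1 (S y) v = ip1 (S y) (S (C v))" for y v
      using S(1) X.ip_diff_right by (metis right_minus_eq)
    then have "ip1 v (S y) = ip1 (S (C v)) (S y)" for y v by (metis X.ip_commute)
    then show ?thesis unfolding self_adjoint_def comp_def using * by metis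
  qed
  ultimately show ?thesis by blast
qed

theorem pinv_penrose:
  assumes C: "bounded_op s1 s2 C" and c: "0 < c"
    and low: "\<And>x. x \<in> orthogonal_complement ip1 {z. C z = 0} \<Longrightarrow> c * norm x \<le> norm (C x)"
  defines "S \<equiv> pinv s1 ip1 s2 ip2 C"
  shows "bounded_op s2 s1 S \<and> C \<circ> S \<circ> C = C \<and> S \<circ> C \<circ> S = S \<and>
     self_adjoint ip2 (C \<circ> S) \<and> self_adjoint ip1 (S \<circ> C)"
proof -
  have "\<exists>!S. bounded_op s2 s1 S \<and> C \<circ> S \<circ> C = C \<and> S \<circ> C \<circ> S = S \<and>
     self_adjoint ip2 (C \<circ> S) \<and> self_adjoint ip1 (S \<circ> C)"
    using pinv_exists[OF C c low] penrose_unique[OF C] by (intro ex_ex1I) auto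
  from theI'[OF this] show ?thesis unfolding S_def pinv_def .
qed

end

section \<open>Weighted least squares for finitely many vectors\<close>

context hilbert_space
begin

definition weighted_frame_op :: "(nat \<Rightarrow> real) \<Rightarrow> (nat \<Rightarrow> 'h) \<Rightarrow> nat set \<Rightarrow> 'h \<Rightarrow> 'h" where
  "weighted_frame_op w f A y = (\<Sum>n\<in>A. smul (of_real (w n) * ip y (f n)) (f n))"

lemma weighted_frame_op_add:
  "weighted_frame_op w f A (x + y) = weighted_frame_op w f A x + weighted_frame_op w f A y"
  by (simp add: weighted_frame_op_def ip_add_left distrib_left scale_left_distrib sum.distrib)

lemma weighted_frame_op_smul:
  "weighted_frame_op w f A (smul c x) = smul c (weighted_frame_op w f A x)"
  by (simp add: weighted_frame_op_def ip_scale_left scale_sum_right algebra_simps)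

lemma ip_weighted_frame_op:
  "ip (weighted_frame_op w f A x) y = ip x (weighted_frame_op w f A y)"
  by (simp add: weighted_frame_op_def ip_sum_left ip_sum_right ip_scale_left ip_scale_right
      cj_mult cj_of_real ip_commute[of "f _" y] algebra_simps)

lemma span_image_mono: "J \<subseteq> L \<Longrightarrow> y \<in> span (f ` J) \<Longrightarrow> y \<in> span (f ` L)"
  using span_mono[of "f ` J" "f ` L"] by blast

lemma orthogonal_to_span:
  assumes "\<And>a. a \<in> S \<Longrightarrow> ip x a = 0" and "y \<in> span S"
  shows "ip x y = 0"
  using assms(2)
  by (induction rule: span_induct_alt) (auto simp: assms(1) ip_add_right ip_scale_right)

text \<open>One step of the Gram-Schmidt process for each vector of \<open>S\<close>.\<close>

lemma finite_span_projection_exists: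
  assumes "finite S"
  shows "\<exists>p\<in>span S. \<forall>a\<in>S. ip (v - p) a = 0"
  using assms
proof (induction S arbitrary: v rule: finite_induct)
  case (insert a S)
  obtain q where q: "q \<in> span S" "\<And>s. s \<in> S \<Longrightarrow> ip (a - q) s = 0" using insert.IH by metis
  obtain p where p: "p \<in> span S" "\<And>s. s \<in> S \<Longrightarrow> ip (v - p) s = 0" using insert.IH by metis
  define h where "h = a - q"
  have sub: "y \<in> span (insert a S)" if "y \<in> span S" for y using that span_mono[of S "insert a S"] by blast
  have h_span: "h \<in> span (insert a S)"
    unfolding h_def by (intro span_diff sub[OF q(1)]) (simp add: span_base)
  have hq: "ip z a = ip z h" if "\<And>s. s \<in> S \<Longrightarrow> ip z s = 0" for z
    using orthogonal_to_span[OF that q(1)] by (simp add: h_def ip_diff_right)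
  show ?case
  proof (cases "h = 0")
    case True
    then have "ip (v - p) a = 0" using hq[OF p(2)] by simp
    then show ?thesis using p sub by auto
  next
    case False
    define c where "c = ip (v - p) h / ip h h"
    have hs: "ip h s = 0" if "s \<in> S" for s using q(2) that by (simp add: h_def)
    have orth: "ip (v - (p + smul c h)) s = 0" if "s \<in> S" for s
      using p(2)[OF that] hs[OF that] by (simp add: ip_diff_left ip_add_left ip_scale_left)
    have "ip (v - (p + smul c h)) h = ip (v - p) h - c * ip h h"
      by (simp add: ip_diff_left ip_add_left ip_scale_left)
    also have "\<dots> = 0" using False by (simp add: c_def)
    finally have "ip (v - (p + smul c h)) a = 0" using hq[OF orth] by simp
    moreover have "p + smul c h \<in> span (insert a S)"
      using p(1) sub h_span by (intro span_add span_scale) auto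
    ultimately show ?thesis using orth by blast
  qed
qed auto

text \<open>The energy identity of a constrained least squares problem. For positive weights it shows that
  the response \<open>ip u v\<close> of a solution to its right-hand side is real and nonnegative, and zero only if
  \<open>u\<close> is orthogonal to all \<open>f n\<close> with \<open>n\<close> in \<open>A\<close>; this replaces the invertibility of a compressed Gram
  matrix below.\<close>

lemma ip_normal_equation:
  assumes perp: "\<And>n. n \<in> E \<Longrightarrow> ip u (f n) = 0"
    and eq: "weighted_frame_op w f A u - v \<in> span (f ` E)"
  shows "ip u v = of_real (\<Sum>n\<in>A. w n * (norm (ip u (f n)))\<^sup>2)"
proof -
  have "ip u (weighted_frame_op w f A u - v) = 0"
    using perp by (intro orthogonal_to_span[OF _ eq]) auto
  then have "ip u v = ip u (weighted_frame_op w f A u)" by (simp add: ip_diff_right)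
  also have "\<dots> = (\<Sum>n\<in>A. of_real (w n) * (ip u (f n) * cj (ip u (f n))))"
    by (simp add: weighted_frame_op_def ip_sum_right ip_scale_right cj_mult cj_of_real algebra_simps)
  also have "\<dots> = of_real (\<Sum>n\<in>A. w n * (norm (ip u (f n)))\<^sup>2)"
    by (simp add: mult_cj)
  finally show ?thesis .
qed

text \<open>Solvability of the normal equation of a weighted least squares problem on the index set \<open>A\<close> with
  homogeneous constraints on \<open>E\<close>, by adding one vector \<open>f m\<close> at a time. The weighted frame operator
  changes by an operator of rank one in the direction of \<open>f m\<close>, so it suffices to correct the
  previous solution along one direction \<open>d\<close>. If \<open>f m\<close> lies in the old span, \<open>d\<close> solves the old
  problem with right-hand side \<open>f m\<close>; otherwise \<open>d\<close> is the component of \<open>f m\<close> orthogonal to the old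
  span.\<close>

lemma normal_equation_solvable:
  assumes "finite A" "finite E" "\<And>n. n \<in> A \<Longrightarrow> 0 < w n" "v \<in> span (f ` (A \<union> E))"
  shows "\<exists>u\<in>span (f ` (A \<union> E)). (\<forall>n\<in>E. ip u (f n) = 0) \<and> weighted_frame_op w f A u - v \<in> span (f ` E)"
  using assms(1,3,4)
proof (induction A arbitrary: v rule: finite_induct)
  case empty
  then show ?case by (intro bexI[of _ 0]) (auto simp: weighted_frame_op_def span_neg span_zero)
next
  case (insert m A)
  let ?G = "weighted_frame_op w f"
  have wm: "0 < w m" and wA: "\<And>n. n \<in> A \<Longrightarrow> 0 < w n" using insert.prems(1) by auto
  have G: "?G (insert m A) u = ?G A u + smul (of_real (w m) * ip u (f m)) (f m)" for u
    using insert.hyps by (simp add: weighted_frame_op_def add.commute)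
  have sub: "y \<in> span (f ` (insert m A \<union> E))" if "y \<in> span (f ` (A \<union> E))" for y
    using that by (rule span_image_mono[rotated]) auto
  obtain k where k: "v - smul k (f m) \<in> span (f ` (A \<union> E))"
    using insert.prems(2) by (auto simp: span_breakdown_eq)
  define v' where "v' = v - smul k (f m)"
  obtain u' where u': "u' \<in> span (f ` (A \<union> E))" "\<And>n. n \<in> E \<Longrightarrow> ip u' (f n) = 0"
      "?G A u' - v' \<in> span (f ` E)"
    using insert.IH[OF wA k] by (auto simp: v'_def)
  \<comment> \<open>the correction of \<open>u'\<close> in a direction \<open>d\<close> along which, up to the span of the constraints,
      only the coefficient of \<open>f m\<close> changes\<close>
  have step: ?case
    if d: "d \<in> span (f ` (insert m A \<union> E))" "\<And>n. n \<in> E \<Longrightarrow> ip d (f n) = 0"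
      "?G A d - smul b (f m) \<in> span (f ` E)" and nz: "b + of_real (w m) * ip d (f m) \<noteq> 0" for d b
  proof -
    define t where "t = (k - of_real (w m) * ip u' (f m)) / (b + of_real (w m) * ip d (f m))"
    have "t * (b + of_real (w m) * ip d (f m)) = k - of_real (w m) * ip u' (f m)"
      using nz by (simp add: t_def)
    then have t: "t * b + of_real (w m) * (ip u' (f m) + t * ip d (f m)) = k"
      by (simp add: algebra_simps)
    have "?G (insert m A) (u' + smul t d) - v = (?G A u' - v') + smul t (?G A d - smul b (f m))
        + smul (t * b + of_real (w m) * (ip u' (f m) + t * ip d (f m)) - k) (f m)"
      by (simp add: G v'_def weighted_frame_op_add weighted_frame_op_smul ip_add_left ip_scale_left
          algebra_simps)
    also have "\<dots> \<in> span (f ` E)"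
      unfolding t using u'(3) d(3) by (simp add: span_add span_scale)
    finally show ?thesis
      using u' d sub by (intro bexI[of _ "u' + smul t d"])
        (auto simp: ip_add_left ip_scale_left intro!: span_add span_scale)
  qed
  show ?case
  proof (cases "f m \<in> span (f ` (A \<union> E))")
    case True
    then obtain d where d: "d \<in> span (f ` (A \<union> E))" "\<And>n. n \<in> E \<Longrightarrow> ip d (f n) = 0"
        "?G A d - f m \<in> span (f ` E)"
      using insert.IH[OF wA True] by auto
    define r where "r = (\<Sum>n\<in>A. w n * (norm (ip d (f n)))\<^sup>2)"
    have "0 \<le> r" unfolding r_def using wA by (intro sum_nonneg mult_nonneg_nonneg) (auto simp: less_imp_le)
    then have "0 < 1 + w m * r" using wm by (simp add: add_pos_nonneg)
    then have "(of_real (1 + w m * r) :: 'k) \<noteq> 0" by (metis less_irrefl of_real_eq_0_iff)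
    then have "1 + of_real (w m) * ip d (f m) \<noteq> 0"
      using ip_normal_equation[OF d(2,3)] by (simp add: r_def)
    then show ?thesis using d sub by (intro step[of d 1]) auto
  next
    case False
    have "finite (f ` (A \<union> E))" using insert.hyps(1) assms(2) by blast
    from finite_span_projection_exists[OF this]
    obtain p where p: "p \<in> span (f ` (A \<union> E))" "\<And>s. s \<in> f ` (A \<union> E) \<Longrightarrow> ip (f m - p) s = 0"
      by blast
    define h where "h = f m - p"
    have h0: "h \<noteq> 0" using False p(1) by (auto simp: h_def)
    have "ip h p = 0" unfolding h_def using p orthogonal_to_span by blast
    then have "ip h (f m) = ip h h" by (simp add: h_def ip_diff_right)
    moreover have "?G A h = 0" using p(2) by (auto simp: weighted_frame_op_def h_def)
    moreover have "h \<in> span (f ` (insert m A \<union> E))"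
      unfolding h_def by (intro span_diff sub[OF p(1)]) (simp add: span_base)
    ultimately show ?thesis using h0 wm p(2) by (intro step[of h 0]) (auto simp: h_def span_zero)
  qed
qed

text \<open>A minimizer of \<open>\<Sum>n\<in>A. w n * \<bar>ip y (f n) - x n\<bar>\<^sup>2\<close> under the constraints \<open>ip y (f n) = x n\<close> for \<open>n\<close> in
  \<open>E\<close>, characterized by its normal equation, is a convex combination of the basic solutions: those
  in the span of some subfamily and interpolating \<open>x\<close> exactly on it. Thus the
  weights enter only through the coefficients of a convex combination.

  As a function of a single weight \<open>w m\<close>, the minimizer moves on a segment. One end, for weight \<open>0\<close>,
  is a minimizer of the problem without the index \<open>m\<close>; the other, for infinite weight, is a
  minimizer of the problem in which \<open>m\<close> is moved from \<open>A\<close> to the constraints \<open>E\<close>. Both have a smaller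
  \<open>A\<close>, and for empty \<open>A\<close> the minimizer is itself a basic solution. Since the segment is parametrized by
  real numbers, this needs only real convexity, over either scalar field.\<close>

theorem least_squares_in_convex_hull_of_basic_solutions:
  fixes x :: "nat \<Rightarrow> 'k"
  assumes "finite A" "finite E" "\<And>n. n \<in> A \<Longrightarrow> 0 < w n" and "convex C"
    and basic: "\<And>J y. J \<subseteq> A \<union> E \<Longrightarrow> y \<in> span (f ` J) \<Longrightarrow> (\<And>n. n \<in> J \<Longrightarrow> ip y (f n) = x n) \<Longrightarrow> y \<in> C"
    and "y \<in> span (f ` (A \<union> E))" "\<And>n. n \<in> E \<Longrightarrow> ip y (f n) = x n"
    and "weighted_frame_op w f A y - (\<Sum>n\<in>A. smul (of_real (w n) * x n) (f n)) \<in> span (f ` E)"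
  shows "y \<in> C"
  using assms(1-3,5-)
proof (induction A arbitrary: E y rule: finite_induct)
  case empty
  show ?case by (rule empty.prems(3)[of E]) (use empty.prems in auto)
next
  case (insert m A)
  let ?G = "weighted_frame_op w f A" and ?b = "\<Sum>n\<in>A. smul (of_real (w n) * x n) (f n)"
  note fin = insert.prems(1) and basic = insert.prems(3) and y = insert.prems(4,5)
  have wm: "0 < w m" and wA: "\<And>n. n \<in> A \<Longrightarrow> 0 < w n" using insert.prems(2) by auto
  define \<rho> where "\<rho> = x m - ip y (f m)"
  have "?G y - ?b - smul (of_real (w m) * \<rho>) (f m)
      = weighted_frame_op w f (insert m A) y - (\<Sum>n\<in>insert m A. smul (of_real (w n) * x n) (f n))"
    using insert.hyps by (simp add: weighted_frame_op_def \<rho>_def algebra_simps)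
  then have res: "?G y - ?b - smul (of_real (w m) * \<rho>) (f m) \<in> span (f ` E)"
    using insert.prems(6) by simp
  have drop: "z \<in> C"
    if "z \<in> span (f ` (A \<union> E))" "\<And>n. n \<in> E \<Longrightarrow> ip z (f n) = x n" "?G z - ?b \<in> span (f ` E)" for z
  proof (rule insert.IH[OF fin wA _ that])
    fix J z' assume "J \<subseteq> A \<union> E" "z' \<in> span (f ` J)" "\<And>n. n \<in> J \<Longrightarrow> ip z' (f n) = x n"
    then show "z' \<in> C" by (intro basic[of J]) auto
  qed
  have constrain: "z \<in> C"
    if "z \<in> span (f ` (insert m A \<union> E))" "\<And>n. n \<in> insert m E \<Longrightarrow> ip z (f n) = x n"
      "?G z - ?b \<in> span (f ` insert m E)" for z
  proof (rule insert.IH[OF _ wA _ _ that(2,3)])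
    show "z \<in> span (f ` (A \<union> insert m E))" using that(1) by simp
    fix J z' assume "J \<subseteq> A \<union> insert m E" "z' \<in> span (f ` J)" "\<And>n. n \<in> J \<Longrightarrow> ip z' (f n) = x n"
    then show "z' \<in> C" by (intro basic[of J]) auto
  qed (use fin in auto)
  have sub: "z \<in> span (f ` insert m E)" if "z \<in> span (f ` E)" for z
    using that by (rule span_image_mono[rotated]) auto
  show ?case
  proof (cases "\<rho> = 0")
    case True
    \<comment> \<open>the constraint at \<open>m\<close> holds already, whatever its weight\<close>
    have "?G y - ?b \<in> span (f ` insert m E)" using res True sub by simp
    moreover have "ip y (f n) = x n" if "n \<in> insert m E" for n
      using that y(2) True by (auto simp: \<rho>_def)
    ultimately show ?thesis using y(1) by (intro constrain)
  next
    case False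
    let ?c = "of_real (w m) * \<rho>"
    have c0: "?c \<noteq> 0" using False wm by simp
    have AE: "z \<in> span (f ` (A \<union> E))" if "z \<in> span (f ` E)" for z
      using that by (rule span_image_mono[rotated]) auto
    have "(?G y - ?b) \<in> span (f ` (A \<union> E))"
      unfolding weighted_frame_op_def by (intro span_diff span_sum span_scale span_base) auto
    from span_diff[OF this AE[OF res]] have "smul ?c (f m) \<in> span (f ` (A \<union> E))" by simp
    from span_scale[OF this, of "inverse ?c"] have fm: "f m \<in> span (f ` (A \<union> E))"
      unfolding scale_scale left_inverse[OF c0] by simp
    then have span_eq: "span (f ` (insert m A \<union> E)) = span (f ` (A \<union> E))"
      using span_redundant by simp
    obtain u where u: "u \<in> span (f ` (A \<union> E))" "\<And>n. n \<in> E \<Longrightarrow> ip u (f n) = 0"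
        "?G u - f m \<in> span (f ` E)"
      using normal_equation_solvable[where w = w, OF insert.hyps(1) fin wA fm] by auto
    define r where "r = (\<Sum>n\<in>A. w n * (norm (ip u (f n)))\<^sup>2)"
    have ip_um: "ip u (f m) = of_real r" using ip_normal_equation[OF u(2,3)] by (simp add: r_def)
    have "0 \<le> r" unfolding r_def using wA by (intro sum_nonneg mult_nonneg_nonneg) (auto simp: less_imp_le)
    \<comment> \<open>\<open>u\<close> is the direction in which the minimizer moves when \<open>w m\<close> varies, and \<open>r\<close> its speed seen by
      \<open>f m\<close>; if \<open>r = 0\<close>, then \<open>f m\<close> lies in the span of the constraints and \<open>w m\<close> has no influence\<close>
    then consider "r = 0" | "0 < r" by linarith
    then show ?thesis
    proof cases
      case 1
      have "\<And>n. n \<in> A \<Longrightarrow> ip u (f n) = 0"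
        using 1 wA insert.hyps(1) unfolding r_def
        by (subst (asm) sum_nonneg_eq_0_iff) (force simp: less_imp_le)+
      then have "?G u = 0" by (simp add: weighted_frame_op_def)
      then have "f m \<in> span (f ` E)" using u(3) span_neg[of "- f m"] by simp
      from span_add[OF res span_scale[OF this, of ?c]] have "?G y - ?b \<in> span (f ` E)" by simp
      then show ?thesis using drop y span_eq by auto
    next
      case 2
      \<comment> \<open>the two ends of the segment: weight \<open>0\<close> and infinite weight for the index \<open>m\<close>\<close>
      define y0 where "y0 = y - smul ?c u"
      define y1 where "y1 = y + smul (\<rho> / of_real r) u"
      have "y0 \<in> C"
      proof (rule drop)
        show "y0 \<in> span (f ` (A \<union> E))"
          unfolding y0_def using y(1) u(1) span_eq by (intro span_diff span_scale) auto
        show "ip y0 (f n) = x n" if "n \<in> E" for n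
          using y(2) u(2) that by (simp add: y0_def ip_diff_left ip_scale_left)
        have "?G y0 = ?G y + smul (- ?c) (?G u)"
          unfolding weighted_frame_op_smul[symmetric] weighted_frame_op_add[symmetric]
          by (simp add: y0_def)
        then have eq: "?G y0 - ?b = (?G y - ?b - smul ?c (f m)) + smul (- ?c) (?G u - f m)"
          by (simp add: scale_right_diff_distrib)
        show "?G y0 - ?b \<in> span (f ` E)"
          unfolding eq using res u(3) by (intro span_add span_scale)
      qed
      moreover have "y1 \<in> C"
      proof (rule constrain)
        show "y1 \<in> span (f ` (insert m A \<union> E))"
          unfolding y1_def using y(1) u(1) span_eq by (intro span_add span_scale) auto
        show "ip y1 (f n) = x n" if "n \<in> insert m E" for n
          using y(2) u(2) that 2 ip_um by (auto simp: y1_def ip_add_left ip_scale_left \<rho>_def)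
        have "?G y1 - ?b = (?G y - ?b - smul ?c (f m)) + smul (\<rho> / of_real r) (?G u - f m)
            + smul (?c + \<rho> / of_real r) (f m)"
          by (simp add: y1_def weighted_frame_op_add weighted_frame_op_smul scale_right_diff_distrib
              scale_left_distrib)
        also have "\<dots> \<in> span (f ` insert m E)"
          by (intro span_add sub[OF res] span_scale sub[OF u(3)]) (simp add: span_base)
        finally show "?G y1 - ?b \<in> span (f ` insert m E)" .
      qed
      moreover have "y = (1 / (1 + w m * r)) *\<^sub>R y0 + (w m * r / (1 + w m * r)) *\<^sub>R y1"
      proof -
        have pos: "0 < 1 + w m * r" using wm 2 by (simp add: add_pos_pos)
        let ?s = "1 / (1 + w m * r)" and ?t = "w m * r / (1 + w m * r)"
        have st: "?s + ?t = 1" using pos by (simp add: field_simps)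
        have "of_real ?t * (\<rho> / of_real r) = of_real (?t / r) * \<rho>" by simp
        also have "?t / r = ?s * w m" using 2 by simp
        finally have cancel: "of_real ?t * (\<rho> / of_real r) - of_real ?s * ?c = 0" by simp
        have "a *\<^sub>R (y - smul c u) + b *\<^sub>R (y + smul d u)
            = (a + b) *\<^sub>R y + smul (of_real b * d - of_real a * c) u" for a b c d
          by (simp add: scale_of_real[symmetric] scale_left_distrib scale_right_distrib
              scale_left_diff_distrib scale_right_diff_distrib)
        then show ?thesis unfolding y0_def y1_def cancel st by (simp only: cancel st scaleR_one) simp
      qed
      moreover have "0 \<le> 1 / (1 + w m * r)" "0 \<le> w m * r / (1 + w m * r)"
        "1 / (1 + w m * r) + w m * r / (1 + w m * r) = 1"
        using wm 2 add_pos_pos[OF zero_less_one mult_pos_pos[OF wm 2]]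
        by (auto simp: add_divide_distrib[symmetric])
      ultimately show ?thesis using convexD[OF \<open>convex C\<close>, of y0 y1] by metis
    qed
  qed
qed

text \<open>The lower Riesz bound for subfamilies bounds every basic solution by the data it interpolates,
  hence puts all of them into one ball, which is convex.\<close>

corollary least_squares_bound:
  fixes x :: "nat \<Rightarrow> 'k"
  assumes A: "finite A" and w: "\<And>n. n \<in> A \<Longrightarrow> 0 < w n" and a: "0 < a"
    and low: "\<And>J y. J \<subseteq> A \<Longrightarrow> y \<in> span (f ` J) \<Longrightarrow> a * (norm y)\<^sup>2 \<le> (\<Sum>n\<in>J. (norm (ip y (f n)))\<^sup>2)"
  shows "\<exists>y. weighted_frame_op w f A y = (\<Sum>n\<in>A. smul (of_real (w n) * x n) (f n)) \<and>
    a * (norm y)\<^sup>2 \<le> (\<Sum>n\<in>A. (norm (x n))\<^sup>2)"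
proof -
  let ?b = "\<Sum>n\<in>A. smul (of_real (w n) * x n) (f n)" and ?q = "\<Sum>n\<in>A. (norm (x n))\<^sup>2"
  have q0: "0 \<le> ?q" by (intro sum_nonneg) auto
  have iff: "z \<in> cball 0 (sqrt (?q / a)) \<longleftrightarrow> a * (norm z)\<^sup>2 \<le> ?q" for z :: 'h
    using real_sqrt_le_iff[of "(norm z)\<^sup>2" "?q / a"] a by (simp add: field_simps)
  have "?b \<in> span (f ` (A \<union> {}))" by (intro span_sum span_scale span_base) auto
  from normal_equation_solvable[where w = w, OF A finite.emptyI w this]
  obtain y where y: "y \<in> span (f ` A)" "weighted_frame_op w f A y - ?b \<in> span (f ` {})" by auto
  have "y \<in> cball 0 (sqrt (?q / a))"
  proof (rule least_squares_in_convex_hull_of_basic_solutions[OF A finite.emptyI w convex_cball _ _ _ y(2)])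
    fix J z assume J: "J \<subseteq> A \<union> {}" and z: "z \<in> span (f ` J)" "\<And>n. n \<in> J \<Longrightarrow> ip z (f n) = x n"
    have "a * (norm z)\<^sup>2 \<le> (\<Sum>n\<in>J. (norm (x n))\<^sup>2)" using low[of J z] J z by simp
    also have "\<dots> \<le> ?q" using J A by (intro sum_mono2) auto
    finally show "z \<in> cball 0 (sqrt (?q / a))" unfolding iff .
  qed (use y in auto)
  then show ?thesis using y(2) unfolding iff by auto
qed

end

section \<open>Square-summable sequences and diagonal operators\<close>

interpretation ell2: hilbert_space "scale_ell2 :: 'k::rc_scalar \<Rightarrow> 'k ell2 \<Rightarrow> 'k ell2" ip_ell2
  by (rule hilbert_space_ell2)

interpretation ell2_pair: hilbert_pair "scale_ell2 :: 'k::rc_scalar \<Rightarrow> 'k ell2 \<Rightarrow> 'k ell2" ip_ell2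
    scale_ell2 ip_ell2
  ..

lemma norm_ell2_sums: "(\<lambda>n. (norm (ell2_nth x n))\<^sup>2) sums (norm x)\<^sup>2"
proof -
  have "(norm x)\<^sup>2 = (\<Sum>n. (norm (ell2_nth x n))\<^sup>2)"
    by (simp add: norm_ell2_def suminf_nonneg[OF ell2_summable])
  then show ?thesis using summable_sums[OF ell2_summable] by simp
qed

lemma norm_ell2_mono:
  assumes "\<And>n. norm (ell2_nth x n) \<le> norm (ell2_nth y n)"
  shows "norm x \<le> norm y"
  unfolding norm_ell2_def
  by (intro real_sqrt_le_mono suminf_le ell2_summable power_mono assms) auto

lemma sum_le_norm_ell2: "finite A \<Longrightarrow> (\<Sum>n\<in>A. (norm (ell2_nth x n))\<^sup>2) \<le> (norm x)\<^sup>2"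
  using sum_le_suminf[OF ell2_summable[of x], of A] sums_unique[OF norm_ell2_sums[of x]] by simp

lemma ell2_nth_sum: "ell2_nth (sum h A) k = (\<Sum>i\<in>A. ell2_nth (h i) k)"
  by (induction A rule: infinite_finite_induct) (auto simp: zero_ell2.rep_eq plus_ell2.rep_eq)

lemma cj_1: "cj (1 :: 'k::rc_scalar) = 1"
  using mult_cj[of "1 :: 'k"] by simp

lemma ip_ell2_basis: "ip_ell2 x (ell2_basis n) = ell2_nth x n"
proof -
  have "ip_ell2 x (ell2_basis n) = (\<Sum>k\<in>{n}. ell2_nth x k * cj (ell2_nth (ell2_basis n) k))"
    unfolding ip_ell2_def by (rule suminf_finite) (auto simp: ell2_basis.rep_eq)
  also have "\<dots> = ell2_nth x n"
    by (simp add: ell2_basis.rep_eq cj_1)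
  finally show ?thesis .
qed

lemma norm_ell2_basis: "norm (ell2_basis n :: 'k::rc_scalar ell2) = 1"
proof -
  have "(norm (ell2_basis n :: 'k ell2))\<^sup>2 = 1"
    using ell2.norm_ip_self[of "ell2_basis n :: 'k ell2"] by (simp add: ip_ell2_basis ell2_basis.rep_eq)
  then show ?thesis using norm_ge_zero[of "ell2_basis n :: 'k ell2"] by (simp add: power2_eq_1_iff)
qed

text \<open>The square of the distance from \<open>x\<close> to its truncation is a tail of the series for the squared norm.\<close>

lemma ell2_expansion:
  "(\<lambda>N. \<Sum>n<N. scale_ell2 (ell2_nth x n) (ell2_basis n)) \<longlonglongrightarrow> x" (is "?t \<longlonglongrightarrow> x")
proof -
  have nth: "ell2_nth (?t N) k = (if k < N then ell2_nth x k else 0)" for N k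
    by (simp add: ell2_nth_sum scale_ell2.rep_eq ell2_basis.rep_eq if_distrib cong: if_cong)
  have "(norm (x - ?t N))\<^sup>2 = (norm x)\<^sup>2 - (\<Sum>n<N. (norm (ell2_nth x n))\<^sup>2)" for N
  proof -
    have "ell2_nth (x - ?t N) k * cj (ell2_nth (?t N) k) = 0" for k
      by (simp add: minus_ell2.rep_eq nth)
    then have "ip_ell2 (x - ?t N) (?t N) = (\<Sum>k. 0)" unfolding ip_ell2_def by presburger
    then have "ip_ell2 (x - ?t N) (?t N) = 0" by simp
    from ell2.pythagoras[OF this] have "(norm x)\<^sup>2 = (norm (x - ?t N))\<^sup>2 + (norm (?t N))\<^sup>2" by simp
    moreover have "(norm (?t N))\<^sup>2 = (\<Sum>n<N. (norm (ell2_nth x n))\<^sup>2)"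
    proof -
      have "(norm (?t N))\<^sup>2 = (\<Sum>k. (norm (ell2_nth (?t N) k))\<^sup>2)"
        by (rule sums_unique[OF norm_ell2_sums])
      also have "\<dots> = (\<Sum>k<N. (norm (ell2_nth (?t N) k))\<^sup>2)"
        by (rule suminf_finite) (auto simp: nth)
      finally show ?thesis by (simp add: nth)
    qed
    ultimately show ?thesis by simp
  qed
  moreover have "(\<lambda>N. (norm x)\<^sup>2 - (\<Sum>n<N. (norm (ell2_nth x n))\<^sup>2)) \<longlonglongrightarrow> (norm x)\<^sup>2 - (norm x)\<^sup>2"
    using norm_ell2_sums[of x] unfolding sums_def by (intro tendsto_intros)
  ultimately have "(\<lambda>N. sqrt ((norm (x - ?t N))\<^sup>2)) \<longlonglongrightarrow> sqrt 0"
    by (intro tendsto_real_sqrt) simp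
  then have "(\<lambda>N. norm (?t N - x)) \<longlonglongrightarrow> 0"
    by (simp only: norm_minus_commute[of x] real_sqrt_abs abs_norm_cancel real_sqrt_zero)
  then show ?thesis by (rule LIM_zero_cancel[OF tendsto_norm_zero_cancel])
qed

definition diag_ell2 :: "(nat \<Rightarrow> real) \<Rightarrow> 'k::rc_scalar ell2 \<Rightarrow> 'k ell2" where
  "diag_ell2 a x = Abs_ell2 (\<lambda>n. of_real (a n) * ell2_nth x n)"

lemma nth_diag_ell2:
  fixes x :: "'k::rc_scalar ell2"
  assumes "\<And>n. \<bar>a n\<bar> \<le> K"
  shows "ell2_nth (diag_ell2 a x) n = of_real (a n) * ell2_nth x n"
proof -
  have "summable (\<lambda>n. (norm (of_real (a n) * ell2_nth x n))\<^sup>2)"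
  proof (rule summable_comparison_test'[where N = 0])
    show "summable (\<lambda>n. K\<^sup>2 * (norm (ell2_nth x n))\<^sup>2)" by (intro summable_mult ell2_summable)
    fix n
    have "(a n)\<^sup>2 \<le> K\<^sup>2" using power_mono[OF assms[of n], of 2] by simp
    then show "norm ((norm (of_real (a n) * ell2_nth x n))\<^sup>2) \<le> K\<^sup>2 * (norm (ell2_nth x n))\<^sup>2"
      by (simp add: norm_mult power_mult_distrib mult_right_mono)
  qed
  then show ?thesis unfolding diag_ell2_def by (simp add: Abs_ell2_inverse)
qed

lemma diag_ell2_bounded_op:
  assumes "\<And>n. \<bar>a n\<bar> \<le> K"
  shows "bounded_op scale_ell2 scale_ell2 (diag_ell2 a :: 'k::rc_scalar ell2 \<Rightarrow> _)"
proof (rule ell2_pair.bounded_opI[where K = K])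
  note nth = nth_diag_ell2[OF assms]
  fix x y :: "'k ell2" and c
  show "diag_ell2 a (x + y) = diag_ell2 a x + diag_ell2 a y"
    by (rule ell2_eqI) (simp add: nth plus_ell2.rep_eq distrib_left)
  show "diag_ell2 a (scale_ell2 c x) = scale_ell2 c (diag_ell2 a x)"
    by (rule ell2_eqI) (simp add: nth scale_ell2.rep_eq)
  have K: "0 \<le> K" using assms[of 0] by linarith
  have "norm (diag_ell2 a x) \<le> norm (K *\<^sub>R x)"
    using assms by (intro norm_ell2_mono)
      (auto simp: nth scaleR_ell2_def scale_ell2.rep_eq norm_mult K intro!: mult_right_mono)
  then show "norm (diag_ell2 a x) \<le> K * norm x" using K by simp
qed

lemma ip_diag_ell2:
  assumes "\<And>n. \<bar>a n\<bar> \<le> K"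
  shows "ip_ell2 (diag_ell2 a x) y = ip_ell2 x (diag_ell2 a y)"
  unfolding ip_ell2_def nth_diag_ell2[OF assms] cj_mult ell2.cj_of_real by (simp add: algebra_simps)

lemma diag_ell2_diag_ell2:
  assumes "\<And>n. \<bar>a n\<bar> \<le> K" "\<And>n. \<bar>b n\<bar> \<le> L"
  shows "diag_ell2 a (diag_ell2 b x) = diag_ell2 (\<lambda>n. a n * b n) x"
  unfolding diag_ell2_def[of a] diag_ell2_def[of "\<lambda>n. a n * b n"] nth_diag_ell2[OF assms(2)]
  by (simp add: mult.assoc)

lemma diag_ell2_1: "diag_ell2 (\<lambda>_. 1) x = x"
  by (simp add: diag_ell2_def ell2_nth_inverse)

lemma diag_ell2_basis:
  assumes "\<And>n. \<bar>a n\<bar> \<le> K"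
  shows "diag_ell2 a (ell2_basis n) = scale_ell2 (of_real (a n)) (ell2_basis n)"
  by (rule ell2_eqI) (simp add: nth_diag_ell2[OF assms] scale_ell2.rep_eq ell2_basis.rep_eq)

lemma has_sum_norm_ell2:
  "((\<lambda>n. (norm (ell2_nth x n))\<^sup>2) has_sum (norm (diag_ell2 (indicator I) x))\<^sup>2) I"
proof -
  have "((\<lambda>n. (norm (ell2_nth (diag_ell2 (indicator I) x) n))\<^sup>2)
      has_sum (norm (diag_ell2 (indicator I) x))\<^sup>2) UNIV"
    by (rule sums_nonneg_imp_has_sum[OF norm_ell2_sums]) simp
  then show ?thesis
    by (rule has_sum_cong_neutral[THEN iffD1, rotated -1])
      (auto simp: nth_diag_ell2[where K = 1 and a = "indicator I"] indicator_def)
qed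

lemma bounded_op_ell2_expansion:
  assumes "hilbert_space smul ip" and T: "bounded_op scale_ell2 smul T"
  shows "(\<lambda>N. \<Sum>n<N. smul (ell2_nth x n) (T (ell2_basis n))) \<longlonglongrightarrow> T x"
proof -
  interpret H: hilbert_space smul ip by fact
  interpret P: hilbert_pair scale_ell2 ip_ell2 smul ip ..
  note bl = P.bounded_op_bounded_linear[OF T]
  have "T (\<Sum>n<N. scale_ell2 (ell2_nth x n) (ell2_basis n))
      = (\<Sum>n<N. smul (ell2_nth x n) (T (ell2_basis n)))" for N
    by (simp add: real_vector.linear_sum[OF bounded_linear.linear[OF bl]] bounded_op_scale[OF T])
  then show ?thesis using bounded_linear.tendsto[OF bl ell2_expansion[of x]] by simp
qed

lemma bounded_op_ell2_ext:
  assumes "hilbert_space smul ip" "bounded_op scale_ell2 smul S" "bounded_op scale_ell2 smul T"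
    and "\<And>n. S (ell2_basis n) = T (ell2_basis n)"
  shows "S = T"
proof
  fix x show "S x = T x"
    using bounded_op_ell2_expansion[OF assms(1,2), of x] bounded_op_ell2_expansion[OF assms(1,3), of x]
      assms(4) by (simp add: LIMSEQ_unique)
qed

lemma diag_ell2_quadratic_form:
  assumes d: "\<And>n. 0 \<le> d n" "\<And>n. d n \<le> K"
  shows "ip_ell2 (diag_ell2 d x) x = of_real ((norm (diag_ell2 (\<lambda>n. sqrt (d n)) x))\<^sup>2)"
proof -
  have s: "\<And>n. \<bar>sqrt (d n)\<bar> \<le> sqrt K" using d by simp
  have "diag_ell2 d x = diag_ell2 (\<lambda>n. sqrt (d n)) (diag_ell2 (\<lambda>n. sqrt (d n)) x)"
    unfolding diag_ell2_diag_ell2[OF s s] using d(1) by simp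
  then show ?thesis
    using ip_diag_ell2[of "\<lambda>n. sqrt (d n)", OF s, of "diag_ell2 (\<lambda>n. sqrt (d n)) x" x] by (simp add: ell2.ip_self)
qed

text \<open>Uniqueness of the square root: a positive \<open>S\<close> with \<open>S \<circ> S = diag_ell2 d\<close> satisfies
  \<open>(S - s) (S + s) e = 0\<close> for each basis vector \<open>e\<close>, where \<open>s\<close> is the root of its eigenvalue. So
  \<open>S e - s e\<close> is in the kernel of \<open>S + s\<close>, which is trivial by positivity.\<close>

lemma sqrt_op_diag_ell2:
  assumes d: "\<And>n. 0 < d n" "\<And>n. d n \<le> K"
  shows "sqrt_op scale_ell2 ip_ell2 (diag_ell2 d) = (diag_ell2 (\<lambda>n. sqrt (d n)) :: 'k::rc_scalar ell2 \<Rightarrow> _)"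
  unfolding sqrt_op_def
proof (rule the_equality)
  let ?E = "diag_ell2 (\<lambda>n. sqrt (d n)) :: 'k ell2 \<Rightarrow> _"
  have dK: "\<And>n. \<bar>d n\<bar> \<le> K" using d by (simp add: less_imp_le)
  have s: "\<And>n. \<bar>sqrt (d n)\<bar> \<le> sqrt K" using d by (simp add: less_imp_le)
  have E: "bounded_op scale_ell2 scale_ell2 ?E" by (rule diag_ell2_bounded_op[OF s])
  have "?E \<circ> ?E = diag_ell2 d"
    using d(1) by (auto simp: diag_ell2_diag_ell2[OF s s] less_imp_le)
  moreover have "positive_op ip_ell2 ?E"
    unfolding positive_op_def self_adjoint_def using ip_diag_ell2[OF s] d
      diag_ell2_quadratic_form[of "\<lambda>n. sqrt (d n)" "sqrt K"]
    by (auto simp: less_imp_le intro!: exI[of _ "(norm _)\<^sup>2"])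
  ultimately show "bounded_op scale_ell2 scale_ell2 ?E \<and> positive_op ip_ell2 ?E \<and> ?E \<circ> ?E = diag_ell2 d"
    using E by blast
  fix S :: "'k ell2 \<Rightarrow> 'k ell2"
  assume "bounded_op scale_ell2 scale_ell2 S \<and> positive_op ip_ell2 S \<and> S \<circ> S = diag_ell2 d"
  then have S: "bounded_op scale_ell2 scale_ell2 S" "positive_op ip_ell2 S" "\<And>x. S (S x) = diag_ell2 d x"
    by (auto simp: fun_eq_iff)
  have S_diff: "S (x - y) = S x - S y" for x y
    by (rule linear_simps(2)[OF ell2_pair.bounded_op_bounded_linear[OF S(1)]])
  show "S = ?E"
  proof (rule bounded_op_ell2_ext[OF hilbert_space_ell2 S(1) E])
    fix n
    define e where "e = (ell2_basis n :: 'k ell2)"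
    define v where "v = S e - sqrt (d n) *\<^sub>R e"
    have Ss: "S (r *\<^sub>R x) = r *\<^sub>R S x" for r x
      by (simp add: scaleR_ell2_def bounded_op_scale[OF S(1)])
    \<comment> \<open>\<open>S\<^sup>2 e = d e\<close> makes \<open>v\<close> an eigenvector of the positive operator \<open>S\<close> for a negative
      eigenvalue, unless \<open>v\<close> vanishes\<close>
    have "diag_ell2 d e = d n *\<^sub>R e" by (simp add: e_def diag_ell2_basis[OF dK] scaleR_ell2_def)
    then have "S v = d n *\<^sub>R e - sqrt (d n) *\<^sub>R S e" by (simp add: v_def S_diff Ss S(3))
    also have "\<dots> = - (sqrt (d n) *\<^sub>R v)"
      using d(1)[of n] by (simp add: v_def scaleR_diff_right)
    finally have Sv: "S v = - (sqrt (d n) *\<^sub>R v)" .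
    obtain r where r: "0 \<le> r" "ip_ell2 (S v) v = of_real r" using S(2) by (auto simp: positive_op_def)
    have "(of_real r :: 'k) = of_real (- (sqrt (d n) * (norm v)\<^sup>2))"
      unfolding r(2)[symmetric] Sv ell2.ip_minus_left ell2.ip_scaleR_left ell2.ip_self by simp
    then have "r = - (sqrt (d n) * (norm v)\<^sup>2)" using of_real_eq_iff by blast
    then have "sqrt (d n) * (norm v)\<^sup>2 \<le> 0" using r(1) by simp
    then have "v = 0" using d(1)[of n] by (simp add: mult_le_0_iff)
    then have "S e = sqrt (d n) *\<^sub>R e" by (simp add: v_def)
    then show "S (ell2_basis n) = ?E (ell2_basis n)"
      by (simp only: e_def diag_ell2_basis[OF s] scaleR_ell2_def)
  qed
qed

lemma inv_sqrt_diag_ell2: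
  assumes d: "0 < l" "\<And>n. l \<le> d n" "\<And>n. d n \<le> K"
  shows "inv_sqrt_ell2 (diag_ell2 d) = (diag_ell2 (\<lambda>n. 1 / sqrt (d n)) :: 'k::rc_scalar ell2 \<Rightarrow> _)"
proof -
  have pos: "0 < d n" for n using d(1) d(2)[of n] by linarith
  have s: "\<And>n. \<bar>sqrt (d n)\<bar> \<le> sqrt K" using d pos by (simp add: less_imp_le)
  have i: "\<bar>1 / sqrt (d n)\<bar> \<le> 1 / sqrt l" for n using d pos[of n] by (simp add: frac_le)
  show ?thesis
    unfolding inv_sqrt_ell2_def sqrt_op_diag_ell2[OF pos d(3)]
    by (rule inv_equality)
      (use pos in \<open>simp_all add: diag_ell2_diag_ell2[OF s i] diag_ell2_diag_ell2[OF i s] less_imp_neq[symmetric] diag_ell2_1\<close>)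
qed

lemma diag_ell2_in_diag_pos_ops:
  assumes d: "0 < l" "\<And>n. l \<le> d n" "\<And>n. d n \<le> K"
  shows "(diag_ell2 d :: 'k::rc_scalar ell2 \<Rightarrow> _) \<in> diag_pos_ops"
proof -
  have pos: "0 < d n" for n using d(1) d(2)[of n] by linarith
  have dK: "\<And>n. \<bar>d n\<bar> \<le> K" using d pos by (simp add: less_imp_le)
  have i: "\<bar>1 / d n\<bar> \<le> 1 / l" for n using d pos[of n] by (simp add: frac_le)
  have i': "\<bar>1 / sqrt (d n)\<bar> \<le> 1 / sqrt l" for n using d pos[of n] by (simp add: frac_le)
  have s: "\<And>n. \<bar>sqrt (d n)\<bar> \<le> sqrt K" using d pos by (simp add: less_imp_le)
  let ?D = "diag_ell2 d :: 'k ell2 \<Rightarrow> _" and ?I = "diag_ell2 (\<lambda>n. 1 / d n) :: 'k ell2 \<Rightarrow> _"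
  have "?I \<circ> ?D = id" "?D \<circ> ?I = id"
    using pos by (auto simp: fun_eq_iff diag_ell2_diag_ell2[OF dK i] diag_ell2_diag_ell2[OF i dK]
        less_imp_neq[symmetric] diag_ell2_1)
  then have "bounded_invertible_op scale_ell2 ?D"
    unfolding bounded_invertible_op_def 
    using diag_ell2_bounded_op[of d, OF dK] diag_ell2_bounded_op[of "\<lambda>n. 1 / d n", OF i] by blast
  moreover have "\<exists>r>0. ip_ell2 (?D x) x = of_real r" if "x \<noteq> 0" for x
  proof -
    have "diag_ell2 (\<lambda>n. 1 / sqrt (d n)) (diag_ell2 (\<lambda>n. sqrt (d n)) x) = x"
      using pos by (simp add: diag_ell2_diag_ell2[OF i' s] less_imp_neq[symmetric] diag_ell2_1)
    moreover have "diag_ell2 a 0 = (0 :: 'k ell2)" for a by (simp add: diag_ell2_def zero_ell2.rep_eq) (simp add: zero_ell2_def)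
    ultimately have "diag_ell2 (\<lambda>n. sqrt (d n)) x \<noteq> 0" using that by auto
    then show ?thesis
      using diag_ell2_quadratic_form[of d K x] pos d(3)
      by (auto simp: less_imp_le intro!: exI[of _ "(norm _)\<^sup>2"])
  qed
  then have "positive_definite_op ip_ell2 ?D"
    by (auto simp: positive_definite_op_def self_adjoint_def ip_diag_ell2[OF dK])
  ultimately show ?thesis unfolding diag_pos_ops_def using diag_ell2_basis[of d, OF dK] by blast
qed

text \<open>The upper bound for the eigenvalues is the operator bound, the lower bound that of the inverse.\<close>

lemma diag_pos_ops_cases:
  assumes "D \<in> diag_pos_ops"
  obtains d l K where "D = diag_ell2 d" "0 < l" "\<And>n. l \<le> d n" "\<And>n. d n \<le> K"
proof -
  have D: "bounded_op scale_ell2 scale_ell2 D" and pd: "positive_definite_op ip_ell2 D"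
    and diag: "\<And>n. \<exists>c. D (ell2_basis n) = scale_ell2 c (ell2_basis n)"
    using assms by (auto simp: diag_pos_ops_def bounded_invertible_op_def)
  obtain S where S: "bounded_op scale_ell2 scale_ell2 S" "\<And>x. S (D x) = x"
    using assms by (auto simp: diag_pos_ops_def bounded_invertible_op_def fun_eq_iff)
  obtain K where K: "K > 0" "\<And>x. norm (D x) \<le> K * norm x" using bounded_op_bound[OF D] by blast
  obtain L where L: "L > 0" "\<And>x. norm (S x) \<le> L * norm x" using bounded_op_bound[OF S(1)] by blast
  have nz: "(ell2_basis n :: 'a ell2) \<noteq> 0" for n using norm_ell2_basis[of n, where 'k='a] by auto
  have "\<exists>r. 0 < r \<and> D (ell2_basis n) = scale_ell2 (of_real r) (ell2_basis n)" for n
  proof -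
    obtain c where c: "D (ell2_basis n) = scale_ell2 c (ell2_basis n)" using diag by blast
    obtain r where r: "r > 0" "ip_ell2 (D (ell2_basis n)) (ell2_basis n) = of_real r"
      using pd nz by (auto simp: positive_definite_op_def)
    have "c = of_real r" using r(2) unfolding c ip_ell2_basis
      by (simp add: scale_ell2.rep_eq ell2_basis.rep_eq)
    then show ?thesis using r(1) c by blast
  qed
  then obtain d where d: "\<And>n. 0 < d n" "\<And>n. D (ell2_basis n) = scale_ell2 (of_real (d n)) (ell2_basis n)"
    by metis
  have upper: "d n \<le> K" for n
    using K(2)[of "ell2_basis n"] d(1)[of n] by (simp add: d(2) ell2.norm_smul norm_ell2_basis)
  have lower: "1 / L \<le> d n" for n
    using L(2)[of "D (ell2_basis n)"] d(1)[of n] L(1)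
    by (simp add: S(2)) (simp add: d(2) ell2.norm_smul norm_ell2_basis field_simps)
  have dK: "\<And>n. \<bar>d n\<bar> \<le> K" using upper d(1) by (simp add: less_imp_le)
  have "D = diag_ell2 d"
    by (rule bounded_op_ell2_ext[OF hilbert_space_ell2 D diag_ell2_bounded_op[OF dK]])
      (simp add: d(2) diag_ell2_basis[OF dK])
  then show ?thesis using that[of d "1 / L" K] L(1) lower upper by simp
qed

section \<open>Synthesis and analysis operators of frames\<close>

context hilbert_space
begin

interpretation syn: hilbert_pair scale_ell2 ip_ell2 smul ip ..

lemma nth_adj_synthesis:
  assumes "synthesis_operator smul f T"
  shows "ell2_nth (adj ip_ell2 ip T y) n = ip y (f n)"
proof -
  have T: "bounded_op scale_ell2 smul T" "T (ell2_basis n) = f n"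
    using assms by (auto simp: synthesis_operator_def)
  show ?thesis
    using syn.adj_eq_right[OF T(1), of y "ell2_basis n"] by (simp add: ip_ell2_basis T(2))
qed

lemma has_sum_synthesis:
  assumes "synthesis_operator smul f T"
  shows "((\<lambda>n. (norm (ip y (f n)))\<^sup>2) has_sum (norm (diag_ell2 (indicator I) (adj ip_ell2 ip T y)))\<^sup>2) I"
  using has_sum_norm_ell2[of "adj ip_ell2 ip T y" I] by (simp add: nth_adj_synthesis[OF assms])

lemma frame_lower_bound:
  assumes "frame ip UNIV f W" and "synthesis_operator smul f T"
  obtains a where "0 < a" "\<And>y. y \<in> W \<Longrightarrow> a * norm y \<le> norm (adj ip_ell2 ip T y)"
proof -
  obtain a where a: "0 < a" "\<And>y. y \<in> W \<Longrightarrow> a * (norm y)\<^sup>2 \<le> (\<Sum>\<^sub>\<infinity>n. (norm (ip y (f n)))\<^sup>2)"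
    using assms(1) by (auto simp: frame_def frame_with_bounds_def)
  have "sqrt a * norm y \<le> norm (adj ip_ell2 ip T y)" if "y \<in> W" for y
  proof -
    have "(sqrt a * norm y)\<^sup>2 \<le> (norm (adj ip_ell2 ip T y))\<^sup>2"
      using a(2)[OF that] infsumI[OF has_sum_synthesis[OF assms(2), of y UNIV]] a(1)
      by (simp add: power_mult_distrib indicator_UNIV[abs_def] diag_ell2_1 indicator_def)
    then show ?thesis by (rule power2_le_imp_le) simp
  qed
  then show ?thesis using that[of "sqrt a"] a(1) by simp
qed

lemma frame_mem: "frame ip UNIV f W \<Longrightarrow> f n \<in> W"
  by (auto simp: frame_def frame_with_bounds_def)

lemma synthesis_mem:
  assumes "synthesis_operator smul f T" "closed_subspace smul W" "\<And>n. f n \<in> W"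
  shows "T x \<in> W"
proof -
  have T: "bounded_op scale_ell2 smul T" "\<And>n. T (ell2_basis n) = f n"
    using assms(1) by (auto simp: synthesis_operator_def)
  have W: "subspace W" "closed W" using assms(2) by (auto simp: closed_subspace_def)
  have "(\<Sum>n<N. smul (ell2_nth x n) (T (ell2_basis n))) \<in> W" for N
    using W(1) assms(3) by (intro subspace_sum subspace_scale) (auto simp: T(2))
  then show ?thesis
    using closed_sequentially[OF W(2) _ bounded_op_ell2_expansion[OF hilbert_space_axioms T(1), of x]] by simp
qed

lemma adj_synthesis_projection:
  assumes "synthesis_operator smul f T" "\<And>n. f n \<in> W" "\<And>u. u \<in> W \<Longrightarrow> ip (y - p) u = 0"
  shows "adj ip_ell2 ip T p = adj ip_ell2 ip T y"
proof (rule ell2_eqI)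
  fix n
  have "ip (y - p) (f n) = 0" using assms(2,3) by blast
  then show "ell2_nth (adj ip_ell2 ip T p) n = ell2_nth (adj ip_ell2 ip T y) n"
    by (simp add: nth_adj_synthesis[OF assms(1)] ip_diff_left)
qed

text \<open>This expresses that the range of the synthesis operator is dense in \<open>W\<close>: the projection to \<open>W\<close> of
  a vector orthogonal to the range is annihilated by the analysis operator, which is bounded below on
  \<open>W\<close>.\<close>

lemma orthogonal_to_synthesis_range:
  assumes f: "frame ip UNIV f W" "synthesis_operator smul f T" and W: "closed_subspace smul W"
    and q: "\<And>x. ip q (T x) = 0"
  shows "q \<in> orthogonal_complement ip W"
proof -
  obtain a where a: "0 < a" "\<And>y. y \<in> W \<Longrightarrow> a * norm y \<le> norm (adj ip_ell2 ip T y)"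
    using frame_lower_bound[OF f] by blast
  obtain p where p: "p \<in> W" "\<And>u. u \<in> W \<Longrightarrow> ip (q - p) u = 0"
    using orthogonal_projection_exists[OF W, of q] by blast
  have "ip q (f n) = 0" for n using q[of "ell2_basis n"] f(2) by (simp add: synthesis_operator_def)
  then have "adj ip_ell2 ip T q = 0"
    by (intro ell2_eqI) (simp add: nth_adj_synthesis[OF f(2)] zero_ell2.rep_eq)
  then have "adj ip_ell2 ip T p = 0"
    using adj_synthesis_projection[OF f(2) frame_mem[OF f(1)] p(2)] by simp
  then have "p = 0" using a(2)[OF p(1)] a(1) by (simp add: mult_le_0_iff)
  then show ?thesis using p(2) by (auto simp: orthogonal_complement_def)
qed

text \<open>The complement of the kernel is contained in the closure of the range of the analysis operator
  \<open>A\<close>, so it is enough to bound \<open>T\<close> below at \<open>A h\<close> with \<open>h\<close> in \<open>W\<close>. There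
  \<open>\<parallel>A h\<parallel>\<^sup>2 = \<langle>T (A h), h\<rangle>\<close>, and \<open>\<parallel>h\<parallel>\<close> is controlled by \<open>\<parallel>A h\<parallel>\<close>.\<close>

lemma synthesis_lower_bound:
  assumes f: "frame ip UNIV f W" "synthesis_operator smul f T" and W: "closed_subspace smul W"
  obtains a where "0 < a" "\<And>x. x \<in> orthogonal_complement ip_ell2 {z. T z = 0} \<Longrightarrow> a * norm x \<le> norm (T x)"
proof -
  let ?A = "adj ip_ell2 ip T"
  have T: "bounded_op scale_ell2 smul T" using f(2) by (simp add: synthesis_operator_def)
  obtain a where a: "0 < a" "\<And>y. y \<in> W \<Longrightarrow> a * norm y \<le> norm (?A y)"
    using frame_lower_bound[OF f] by blast
  interpret swap: hilbert_pair smul ip scale_ell2 ip_ell2 ..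
  have on_range: "a * norm (?A h) \<le> norm (T (?A h))" for h
  proof -
    obtain p where p: "p \<in> W" "\<And>u. u \<in> W \<Longrightarrow> ip (h - p) u = 0"
      using orthogonal_projection_exists[OF W, of h] by blast
    have Ah: "?A h = ?A p" using adj_synthesis_projection[OF f(2) frame_mem[OF f(1)] p(2)] by simp
    have "a * (norm (?A p))\<^sup>2 = a * norm (ip (T (?A p)) p)"
      by (simp add: syn.adj_eq[OF T] ell2.norm_ip_self)
    also have "\<dots> \<le> norm (T (?A p)) * (a * norm p)"
      using cauchy_schwarz[of "T (?A p)" p] a(1) by (simp add: mult.left_commute mult_left_mono)
    also have "\<dots> \<le> norm (T (?A p)) * norm (?A p)" using a(2)[OF p(1)] by (rule mult_left_mono) simp
    finally show ?thesis unfolding Ah by (cases "?A p = 0") (auto simp: power2_eq_square)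
  qed
  have "a * norm x \<le> norm (T x)" if x: "x \<in> orthogonal_complement ip_ell2 {z. T z = 0}" for x
  proof -
    define U where "U = closure (range ?A)"
    have U: "closed_subspace scale_ell2 U"
      unfolding U_def by (rule ell2.closed_subspace_closure[OF swap.range_subspace[OF syn.adj_bounded_op[OF T]]])
    obtain p where p: "p \<in> U" "\<And>u. u \<in> U \<Longrightarrow> ip_ell2 (x - p) u = 0"
      using ell2.orthogonal_projection_exists[OF U, of x] by blast
    have "ip (T (x - p)) h = 0" for h
    proof -
      have "?A h \<in> U" unfolding U_def by (rule subsetD[OF closure_subset]) (rule rangeI)
      then show ?thesis using p(2) by (simp add: syn.adj_eq[OF T])
    qed
    then have "T (x - p) = 0" using ip_self_eq_0_iff by blast
    then have "ip_ell2 x (x - p) = 0" using x by (simp add: orthogonal_complement_def)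
    moreover have "ip_ell2 p (x - p) = 0" using p ell2.ip_eq_0_commute by blast
    ultimately have "ip_ell2 (x - p) (x - p) = 0" by (simp add: ell2.ip_diff_left)
    then have "x \<in> U" using p(1) by simp
    moreover have "U \<subseteq> {z. a * norm z \<le> norm (T z)}"
      unfolding U_def using on_range
      by (intro closure_minimal closed_Collect_le continuous_intros
          bounded_linear.continuous_on[OF syn.bounded_op_bounded_linear[OF T]]) auto
    ultimately show ?thesis by blast
  qed
  then show ?thesis using that a(1) by blast
qed

text \<open>Elements \<open>m\<close> of \<open>M\<close> whose orthogonal projections \<open>p\<close> to \<open>W\<close> lie in the unit ball are weakly bounded: if
  \<open>h = w + n\<close> with \<open>w\<close> in \<open>W\<close> and \<open>n\<close> orthogonal to \<open>M\<close>, then \<open>ip m h = ip p w\<close>. The uniform boundedness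
  principle turns this into the norm bound.\<close>

lemma oblique_projection_bound:
  assumes W: "closed_subspace smul W" and M: "closed_subspace smul M"
    and dec: "direct_sum_decomposition W (orthogonal_complement ip M)"
  obtains \<kappa> where "0 < \<kappa>"
    "\<And>m p. m \<in> M \<Longrightarrow> p \<in> W \<Longrightarrow> (\<And>w. w \<in> W \<Longrightarrow> ip (m - p) w = 0) \<Longrightarrow> norm m \<le> \<kappa> * norm p"
proof -
  have split: "\<exists>w\<in>W. \<exists>n. (\<forall>m\<in>M. ip m n = 0) \<and> h = w + n" for h
  proof -
    obtain w n where "w \<in> W" "n \<in> orthogonal_complement ip M" "h = w + n"
      using dec unfolding direct_sum_decomposition_def by blast
    then show ?thesis using ip_eq_0_commute unfolding orthogonal_complement_def by blast
  qed
  define Y where "Y = {m\<in>M. \<exists>p\<in>W. (\<forall>w\<in>W. ip (m - p) w = 0) \<and> norm p \<le> 1}"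
  have "\<exists>c. \<forall>y\<in>Y. norm y \<le> c"
  proof (rule weakly_bounded_imp_bounded)
    fix h
    obtain w n where w: "w \<in> W" "\<forall>m\<in>M. ip m n = 0" "h = w + n" using split by blast
    have "norm (ip m h) \<le> norm w" if m: "m \<in> Y" for m
    proof -
      obtain p where p: "m \<in> M" "p \<in> W" "\<forall>w\<in>W. ip (m - p) w = 0" "norm p \<le> 1"
        using m by (auto simp: Y_def)
      have "ip (m - p) w = 0" using p(3) w(1) by blast
      then have "ip m h = ip p w" using w p(1) by (simp add: ip_add_right ip_diff_left)
      also have "norm \<dots> \<le> norm p * norm w" by (rule cauchy_schwarz)
      also have "\<dots> \<le> norm w" using p(4) by (simp add: mult_left_le_one_le)
      finally show ?thesis .
    qed
    then show "\<exists>c. \<forall>y\<in>Y. norm (ip y h) \<le> c" by blast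
  qed
  then obtain c where c: "\<And>y. y \<in> Y \<Longrightarrow> norm y \<le> c" by blast
  have "norm m \<le> (\<bar>c\<bar> + 1) * norm p"
    if m: "m \<in> M" "p \<in> W" "\<And>w. w \<in> W \<Longrightarrow> ip (m - p) w = 0" for m p
  proof (cases "p = 0")
    case True
    obtain w n where w: "w \<in> W" "\<forall>m\<in>M. ip m n = 0" "m = w + n" using split by blast
    have "ip m m = ip m w + ip m n" by (subst (2) w(3)) (rule ip_add_right)
    also have "\<dots> = 0" using m(3)[OF w(1)] w(2) m(1) True by simp
    finally show ?thesis by simp
  next
    case False
    let ?r = "inverse (norm p)"
    have "?r *\<^sub>R m \<in> Y"
    proof -
      have "?r *\<^sub>R m \<in> M" "?r *\<^sub>R p \<in> W"
        using m W M by (auto simp: closed_subspace_def intro: subspace_scaleR)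
      moreover have "ip (?r *\<^sub>R m - ?r *\<^sub>R p) w = 0" if "w \<in> W" for w
        using m(3)[OF that] by (simp add: scaleR_diff_right[symmetric] ip_scaleR_left)
      moreover have "norm (?r *\<^sub>R p) \<le> 1" using False by simp
      ultimately show ?thesis unfolding Y_def by blast
    qed
    from c[OF this] have "norm m \<le> c * norm p" using False by (simp add: field_simps)
    also have "\<dots> \<le> (\<bar>c\<bar> + 1) * norm p" by (intro mult_right_mono) auto
    finally show ?thesis .
  qed
  then show ?thesis by (intro that[of "\<bar>c\<bar> + 1"]) auto
qed

end

section \<open>Oblique weighted pseudoinverses and Riesz frames\<close>

text \<open>In the comments below, \<open>T*\<close> is the analysis operator, \<open>R\<close> is the inverse square
  root of the diagonal operator with entries \<open>d\<close>, and the weights are \<open>1 / d n\<close>.\<close>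

locale oblique_frame_pair = hilbert_space smul ip
  for smul :: "'k::rc_scalar \<Rightarrow> 'h::banach \<Rightarrow> 'h" and ip :: "'h \<Rightarrow> 'h \<Rightarrow> 'k" +
  fixes W M :: "'h set" and f g :: "nat \<Rightarrow> 'h" and T B :: "'k ell2 \<Rightarrow> 'h"
  assumes W: "closed_subspace smul W" and f: "frame ip UNIV f W" and T: "synthesis_operator smul f T"
    and M: "closed_subspace smul M" and dec: "direct_sum_decomposition W (orthogonal_complement ip M)"
    and g: "frame ip UNIV g M" and B: "synthesis_operator smul g B"
begin

interpretation syn: hilbert_pair scale_ell2 ip_ell2 smul ip ..
interpretation ana: hilbert_pair smul ip scale_ell2 ip_ell2 ..
interpretation self: hilbert_pair smul ip smul ip ..

abbreviation analysis :: "'h \<Rightarrow> 'k ell2" where "analysis \<equiv> adj ip_ell2 ip T"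

abbreviation inv_root :: "(nat \<Rightarrow> real) \<Rightarrow> 'k ell2 \<Rightarrow> 'k ell2" where
  "inv_root d \<equiv> diag_ell2 (\<lambda>n. 1 / sqrt (d n))"

definition oblique_weighted_pinv :: "(nat \<Rightarrow> real) \<Rightarrow> 'k ell2 \<Rightarrow> 'h" where
  "oblique_weighted_pinv d =
    B \<circ> pinv scale_ell2 ip_ell2 scale_ell2 ip_ell2 (inv_root d \<circ> analysis \<circ> B) \<circ> inv_root d"

lemma T_op: "bounded_op scale_ell2 smul T" and B_op: "bounded_op scale_ell2 smul B"
  using T B by (auto simp: synthesis_operator_def)

lemma analysis_op: "bounded_op smul scale_ell2 analysis"
  by (rule syn.adj_bounded_op[OF T_op])

lemmas nth_analysis = nth_adj_synthesis[OF T]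

lemma analysis_diff: "analysis (x - y) = analysis x - analysis y"
  by (rule linear_simps(2)[OF ana.bounded_op_bounded_linear[OF analysis_op]])

lemma T_mem: "T x \<in> W" and B_mem: "B x \<in> M"
  using synthesis_mem[OF T W frame_mem[OF f]] synthesis_mem[OF B M frame_mem[OF g]] by auto

text \<open>Replacing \<open>m\<close> in \<open>M\<close> by its orthogonal projection to \<open>W\<close> does not change its frame coefficients, and
  costs only a constant factor of the norm.\<close>

lemma analysis_lower_bound_on_M:
  obtains a where "0 < a" "\<And>m. m \<in> M \<Longrightarrow> a * norm m \<le> norm (analysis m)"
proof -
  obtain a where a: "0 < a" "\<And>y. y \<in> W \<Longrightarrow> a * norm y \<le> norm (analysis y)"
    using frame_lower_bound[OF f T] by blast
  obtain \<kappa> where \<kappa>: "0 < \<kappa>"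
    "\<And>m p. m \<in> M \<Longrightarrow> p \<in> W \<Longrightarrow> (\<And>w. w \<in> W \<Longrightarrow> ip (m - p) w = 0) \<Longrightarrow> norm m \<le> \<kappa> * norm p"
    using oblique_projection_bound[OF W M dec] by blast
  have "a / \<kappa> * norm m \<le> norm (analysis m)" if m: "m \<in> M" for m
  proof -
    obtain p where p: "p \<in> W" "\<And>w. w \<in> W \<Longrightarrow> ip (m - p) w = 0"
      using orthogonal_projection_exists[OF W, of m] by blast
    have "a / \<kappa> * norm m \<le> a / \<kappa> * (\<kappa> * norm p)"
      using \<kappa>(2)[OF m p] a(1) \<kappa>(1) by (intro mult_left_mono) auto
    also have "\<dots> \<le> norm (analysis p)" using a(2)[OF p(1)] \<kappa>(1) by simp
    also have "analysis p = analysis m" by (rule adj_synthesis_projection[OF T frame_mem[OF f] p(2)])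
    finally show ?thesis .
  qed
  then show ?thesis using that[of "a / \<kappa>"] a(1) \<kappa>(1) by simp
qed

context
  fixes d :: "nat \<Rightarrow> real" and l K :: real
  assumes d: "0 < l" "\<And>n. l \<le> d n" "\<And>n. d n \<le> K"
begin

lemma weight_pos: "0 < d n"
  using d(1) d(2)[of n] by linarith

lemma weight_bounds:
  "\<bar>1 / sqrt (d n)\<bar> \<le> 1 / sqrt l" "\<bar>1 / d n\<bar> \<le> 1 / l" "\<bar>sqrt (d n)\<bar> \<le> sqrt K"
  using d(1) d(2,3)[of n] weight_pos[of n] by (auto simp: frac_le less_imp_le)

lemma inv_root_op: "bounded_op scale_ell2 scale_ell2 (inv_root d)"
  by (rule diag_ell2_bounded_op) (rule weight_bounds(1))

lemma inv_root_twice: "inv_root d (inv_root d x) = diag_ell2 (\<lambda>n. 1 / d n) x"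
  using diag_ell2_diag_ell2[of "\<lambda>n. 1 / sqrt (d n)", OF weight_bounds(1), of "\<lambda>n. 1 / sqrt (d n)", OF weight_bounds(1)]
    weight_pos by (simp add: less_imp_le)

lemma ip_inv_root: "ip_ell2 (inv_root d x) y = ip_ell2 x (inv_root d y)"
  by (rule ip_diag_ell2) (rule weight_bounds(1))

lemma inv_root_lower: "norm x \<le> sqrt K * norm (inv_root d x)"
proof (rule order_trans)
  have K: "0 \<le> sqrt K" using weight_bounds(3)[of 0] by linarith
  show "norm x \<le> norm (sqrt K *\<^sub>R inv_root d x)"
  proof (rule norm_ell2_mono)
    fix n
    have nth: "ell2_nth (inv_root d x) n = of_real (1 / sqrt (d n)) * ell2_nth x n"
      by (rule nth_diag_ell2) (rule weight_bounds(1))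
    have "1 * norm (ell2_nth x n) \<le> (sqrt K * (1 / sqrt (d n))) * norm (ell2_nth x n)"
      using d(3)[of n] weight_pos[of n] by (intro mult_right_mono) auto
    then show "norm (ell2_nth x n) \<le> norm (ell2_nth (sqrt K *\<^sub>R inv_root d x) n)"
      using weight_pos[of n] K
      by (simp add: nth scaleR_ell2_def scale_ell2.rep_eq norm_mult norm_divide)
  qed
  show "norm (sqrt K *\<^sub>R inv_root d x) \<le> sqrt K * norm (inv_root d x)" using K by simp
qed

lemma cross_gram_op: "bounded_op scale_ell2 scale_ell2 (inv_root d \<circ> analysis \<circ> B)"
  by (intro bounded_op_compose[OF B_op] bounded_op_compose[OF analysis_op] inv_root_op)

text \<open>Each factor of \<open>R T* B\<close> is bounded below where it is needed: \<open>B\<close> on the complement of its kernel, \<open>T*\<close>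
  on \<open>M\<close>, and \<open>R\<close> everywhere. In particular the product has the same kernel as \<open>B\<close>, and a bounded
  pseudoinverse.\<close>

lemma cross_gram_lower_bound:
  obtains c where "0 < c" "\<And>x. x \<in> orthogonal_complement ip_ell2 {z. (inv_root d \<circ> analysis \<circ> B) z = 0} \<Longrightarrow>
    c * norm x \<le> norm ((inv_root d \<circ> analysis \<circ> B) x)"
proof -
  let ?C = "inv_root d \<circ> analysis \<circ> B"
  obtain a where a: "0 < a" "\<And>m. m \<in> M \<Longrightarrow> a * norm m \<le> norm (analysis m)"
    using analysis_lower_bound_on_M by blast
  obtain b where b: "0 < b" "\<And>x. x \<in> orthogonal_complement ip_ell2 {z. B z = 0} \<Longrightarrow> b * norm x \<le> norm (B x)"
    using synthesis_lower_bound[OF g B M] by blast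
  have K: "0 < sqrt K" using weight_pos[of 0] d(3)[of 0] by simp
  have CB: "a * norm (B x) \<le> sqrt K * norm (?C x)" for x
    using order_trans[OF a(2)[OF B_mem] inv_root_lower] by simp
  have "B z = 0 \<Longrightarrow> ?C z = 0" for z
    using linear_simps(3)[OF ana.bounded_op_bounded_linear[OF analysis_op]]
      linear_simps(3)[OF ell2_pair.bounded_op_bounded_linear[OF inv_root_op]] by simp
  moreover have "?C z = 0 \<Longrightarrow> B z = 0" for z
    using CB[of z] a(1) by (simp add: mult_le_0_iff)
  ultimately have ker: "{z. ?C z = 0} = {z. B z = 0}" by blast
  have "a * b / sqrt K * norm x \<le> norm (?C x)" if "x \<in> orthogonal_complement ip_ell2 {z. ?C z = 0}" for x
  proof -
    have "b * norm x \<le> norm (B x)" using b(2) that unfolding ker by blast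
    then have "a * (b * norm x) \<le> sqrt K * norm (?C x)"
      using CB[of x] a(1) by (meson mult_left_mono less_imp_le order_trans)
    then show ?thesis using K by (simp add: field_simps)
  qed
  then show ?thesis using that[of "a * b / sqrt K"] a(1) b(1) K by simp
qed

lemma oblique_weighted_pinv_op: "bounded_op scale_ell2 smul (oblique_weighted_pinv d)"
proof -
  obtain c where c: "0 < c" "\<And>x. x \<in> orthogonal_complement ip_ell2 {z. (inv_root d \<circ> analysis \<circ> B) z = 0} \<Longrightarrow>
      c * norm x \<le> norm ((inv_root d \<circ> analysis \<circ> B) x)"
    using cross_gram_lower_bound by blast
  have "bounded_op scale_ell2 scale_ell2 (pinv scale_ell2 ip_ell2 scale_ell2 ip_ell2 (inv_root d \<circ> analysis \<circ> B))"
    using ell2_pair.pinv_penrose[OF cross_gram_op c] by blast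
  then show ?thesis
    unfolding oblique_weighted_pinv_def
    by (intro bounded_op_compose[OF inv_root_op] bounded_op_compose[OF _ B_op])
qed

lemma oblique_weighted_pinv_mem: "oblique_weighted_pinv d x \<in> M"
  by (simp add: oblique_weighted_pinv_def B_mem)

text \<open>The vector \<open>y = B (R T* B)\<^sup>\<dagger> R x\<close> solves the weighted least squares problem for the coefficients \<open>x\<close>.
  The residual of a pseudoinverse is orthogonal to the range, so the weighted residual, synthesized
  to \<open>q\<close> in \<open>W\<close>, is orthogonal to the range of \<open>B\<close>. Hence \<open>q\<close> lies in \<open>W\<close> and in the complement of
  \<open>M\<close>, which meet only in \<open>0\<close>.\<close>

lemma oblique_weighted_pinv_normal_equation:
  "T (diag_ell2 (\<lambda>n. 1 / d n) (x - analysis (oblique_weighted_pinv d x))) = 0"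
proof -
  let ?C = "inv_root d \<circ> analysis \<circ> B"
  define S where "S = pinv scale_ell2 ip_ell2 scale_ell2 ip_ell2 ?C"
  obtain c where c: "0 < c" "\<And>x. x \<in> orthogonal_complement ip_ell2 {z. ?C z = 0} \<Longrightarrow> c * norm x \<le> norm (?C x)"
    using cross_gram_lower_bound by blast
  have S: "?C \<circ> S \<circ> ?C = ?C" "self_adjoint ip_ell2 (?C \<circ> S)"
    using ell2_pair.pinv_penrose[OF cross_gram_op c] unfolding S_def[symmetric] by blast+
  have CS: "ip_ell2 (?C (S y)) (?C v) = ip_ell2 y (?C v)" for y v
    using S by (metis comp_apply self_adjoint_def)
  define y where "y = oblique_weighted_pinv d x"
  have y: "y = B (S (inv_root d x))" by (simp add: y_def oblique_weighted_pinv_def S_def)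
  let ?q = "T (diag_ell2 (\<lambda>n. 1 / d n) (x - analysis y))"
  have "ip ?q (B v) = 0" for v
  proof -
    have "ip ?q (B v) = ip_ell2 (inv_root d (x - analysis y)) (?C v)"
      by (simp add: syn.adj_eq[OF T_op] inv_root_twice[symmetric] ip_inv_root)
    also have "inv_root d (x - analysis y) = inv_root d x - ?C (S (inv_root d x))"
      using linear_simps(2)[OF ell2_pair.bounded_op_bounded_linear[OF inv_root_op]] by (simp add: y)
    also have "ip_ell2 \<dots> (?C v) = 0"
      using CS[of "inv_root d x" v] by (simp only: ell2.ip_diff_left diff_self)
    finally show ?thesis .
  qed
  then have "?q \<in> orthogonal_complement ip M" by (rule orthogonal_to_synthesis_range[OF g B M])
  then have "?q = 0" using T_mem dec by (auto simp: direct_sum_decomposition_def)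
  then show ?thesis by (simp add: y_def)
qed

lemma oblique_weighted_pinv_minimal:
  "norm (inv_root d (x - analysis (oblique_weighted_pinv d x))) \<le> norm (inv_root d (x - analysis h))"
proof -
  define y where "y = oblique_weighted_pinv d x"
  define e where "e = inv_root d (x - analysis y)"
  define e' where "e' = inv_root d (analysis (y - h))"
  have "ip_ell2 e e' = ip (T (diag_ell2 (\<lambda>n. 1 / d n) (x - analysis y))) (y - h)"
    by (simp add: e_def e'_def ip_inv_root[symmetric] inv_root_twice syn.adj_eq[OF T_op])
  then have "ip_ell2 e e' = 0" using oblique_weighted_pinv_normal_equation by (simp add: y_def)
  from ell2.pythagoras[OF this] have "(norm e)\<^sup>2 \<le> (norm (e + e'))\<^sup>2" by simp
  moreover have "e + e' = inv_root d (x - analysis h)"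
    unfolding e_def e'_def bounded_op_add[OF inv_root_op, symmetric] by (simp add: analysis_diff)
  ultimately show ?thesis unfolding e_def y_def by (metis norm_ge_zero power2_le_imp_le)
qed

end

text \<open>Fix an index set \<open>I\<close> and \<open>x\<close> in the closed span of the \<open>f n\<close> with \<open>n\<close> in \<open>I\<close>, and let \<open>u\<close> be the
  frame coefficients of \<open>x\<close> on \<open>I\<close>, extended by \<open>0\<close>. The lower Riesz bound says that \<open>u\<close> controls
  \<open>x\<close>. Solve the weighted least squares problems for \<open>u\<close> with weight \<open>1\<close> on \<open>I\<close> and weights tending to
  \<open>0\<close> off \<open>I\<close>. The competitor \<open>x\<close> shows that the residual tends to \<open>0\<close> on \<open>I\<close>, so the solutions \<open>y k\<close>
  have asymptotically the same inner products as \<open>x\<close> with the span of these \<open>f n\<close>; and by hypothesis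
  they stay bounded by \<open>c * norm u\<close>. Testing with \<open>x\<close> itself bounds \<open>norm x\<close>.\<close>

lemma riesz_frame_if_uniformly_bounded:
  assumes bound: "\<And>d l K x. 0 < l \<Longrightarrow> (\<And>n. l \<le> d n) \<Longrightarrow> (\<And>n. d n \<le> K) \<Longrightarrow>
    norm (oblique_weighted_pinv d x) \<le> c * norm x"
  shows "riesz_frame smul ip f W"
proof -
  let ?P = "\<lambda>I. diag_ell2 (indicator I) :: 'k ell2 \<Rightarrow> 'k ell2"
  have ind: "\<bar>indicator I n :: real\<bar> \<le> 1" for I and n :: nat by (simp add: indicator_def)
  have lower: "norm x \<le> c * norm (?P I (analysis x))" if x: "x \<in> closed_span smul (f ` I)" for I x
  proof -
    define u where "u = ?P I (analysis x)"
    \<comment> \<open>the weights are the reciprocals of the entries: \<open>1\<close> on \<open>I\<close> and \<open>1 / Suc k\<close> elsewhere\<close>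
    define d where "d k n = (if n \<in> I then 1 else real (Suc k))" for k n
    define y where "y k = oblique_weighted_pinv (d k) u" for k
    have d: "1 \<le> d k n" "d k n \<le> real (Suc k)" for k n by (auto simp: d_def)
    have wb: "\<bar>1 / sqrt (d k n)\<bar> \<le> 1 / sqrt 1" for k n by (rule weight_bounds(1)[OF zero_less_one d])
    have nth_u: "ell2_nth u n = of_real (indicator I n) * ip x (f n)" for n
      unfolding u_def nth_diag_ell2[of "indicator I", OF ind] nth_analysis by simp
    have nth_res: "ell2_nth (inv_root (d k) (u - analysis h)) n
        = of_real (1 / sqrt (d k n)) * (ell2_nth u n - ip h (f n))" for k n h
      unfolding nth_diag_ell2[of "\<lambda>n. 1 / sqrt (d k n)", OF wb] minus_ell2.rep_eq nth_analysis by simp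
    have y_bound: "norm (y k) \<le> c * norm u" for k
      unfolding y_def by (rule bound[OF zero_less_one d])
    have coeff: "norm (ip (x - y k) (f n)) \<le> norm (analysis x) * sqrt (inverse (real (Suc k)))"
      if n: "n \<in> I" for n k
    proof -
      have "ip (x - y k) (f n) = ell2_nth (inv_root (d k) (u - analysis (y k))) n"
        unfolding nth_res nth_u using n by (simp add: d_def ip_diff_left)
      also have "norm \<dots> \<le> norm (inv_root (d k) (u - analysis (y k)))" by (rule norm_ell2_nth_le)
      also have "\<dots> \<le> norm (inv_root (d k) (u - analysis x))"
        unfolding y_def by (rule oblique_weighted_pinv_minimal[OF zero_less_one d])
      also have "\<dots> \<le> norm (sqrt (inverse (real (Suc k))) *\<^sub>R analysis x)"
      proof (rule norm_ell2_mono)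
        fix i
        show "norm (ell2_nth (inv_root (d k) (u - analysis x)) i)
            \<le> norm (ell2_nth (sqrt (inverse (real (Suc k))) *\<^sub>R analysis x) i)"
          unfolding nth_res nth_u scaleR_ell2_def scale_ell2.rep_eq nth_analysis
          by (cases "i \<in> I") (simp_all add: d_def norm_mult norm_divide inverse_eq_divide real_sqrt_divide)
      qed
      finally show ?thesis by (simp add: mult.commute)
    qed
    have lim_f: "(\<lambda>k. ip (x - y k) (f n)) \<longlonglongrightarrow> 0" if "n \<in> I" for n
    proof (rule Lim_null_comparison)
      show "\<forall>\<^sub>F k in sequentially. norm (ip (x - y k) (f n)) \<le> norm (analysis x) * sqrt (inverse (real (Suc k)))"
        using coeff[OF that] by (intro always_eventually) blast
      show "(\<lambda>k. norm (analysis x) * sqrt (inverse (real (Suc k)))) \<longlonglongrightarrow> 0"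
        using tendsto_mult[OF tendsto_const[of "norm (analysis x)"] tendsto_real_sqrt[OF LIMSEQ_inverse_real_of_nat]]
        by simp
    qed
    have lim: "(\<lambda>k. ip (x - y k) v) \<longlonglongrightarrow> 0" if "v \<in> span (f ` I)" for v
      using that
    proof (induction rule: span_induct_alt)
      case (step a b v)
      then have "(\<lambda>k. cj a * ip (x - y k) b + ip (x - y k) v) \<longlonglongrightarrow> cj a * 0 + 0"
        using lim_f by (intro tendsto_intros) auto
      then show ?case by (simp add: ip_add_right ip_scale_right)
    qed simp
    have "norm (ip x v) \<le> c * norm u * norm v" if v: "v \<in> span (f ` I)" for v
    proof (rule LIMSEQ_le_const)
      show "(\<lambda>k. norm (ip (x - y k) v) + c * norm u * norm v) \<longlonglongrightarrow> c * norm u * norm v"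
        using tendsto_add[OF tendsto_norm_zero[OF lim[OF v]] tendsto_const] by simp
      have "norm (ip x v) \<le> norm (ip (x - y k) v) + c * norm u * norm v" for k
      proof -
        have "ip x v = ip (x - y k) v + ip (y k) v" by (simp add: ip_diff_left)
        then have "norm (ip x v) \<le> norm (ip (x - y k) v) + norm (ip (y k) v)"
          by (metis norm_triangle_ineq)
        also have "norm (ip (y k) v) \<le> c * norm u * norm v"
          using order_trans[OF cauchy_schwarz mult_right_mono[OF y_bound]] by simp
        finally show ?thesis by simp
      qed
      then show "\<exists>N. \<forall>k\<ge>N. norm (ip x v) \<le> norm (ip (x - y k) v) + c * norm u * norm v" by blast
    qed
    then have "closure (span (f ` I)) \<subseteq> {v. norm (ip x v) \<le> c * norm u * norm v}"
      by (intro closure_minimal closed_Collect_le continuous_intros continuous_on_ip) auto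
    then have "norm (ip x x) \<le> c * norm u * norm x" using x by (auto simp: closed_span_def)
    moreover have "0 \<le> c * norm u" using y_bound[of 0] norm_ge_zero order_trans by blast
    ultimately show ?thesis
      unfolding u_def[symmetric] by (cases "x = 0") (auto simp: norm_ip_self power2_eq_square)
  qed
  obtain K where K: "0 < K" "\<And>x. norm (analysis x) \<le> K * norm x"
    using bounded_op_bound[OF analysis_op] by blast
  have "frame_with_bounds ip I f (closed_span smul (f ` I)) (1 / (c\<^sup>2 + 1)) (K\<^sup>2)" for I
    unfolding frame_with_bounds_def
  proof (intro conjI ballI)
    show "f ` I \<subseteq> closed_span smul (f ` I)"
      unfolding closed_span_def by (rule order_trans[OF span_superset closure_subset])
    show "0 < 1 / (c\<^sup>2 + 1)" by (simp add: add_nonneg_pos)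
    show "0 < K\<^sup>2" using K(1) by simp
    fix x assume x: "x \<in> closed_span smul (f ` I)"
    let ?u = "?P I (analysis x)"
    note sum = has_sum_synthesis[OF T, of x I]
    show "(\<lambda>n. (norm (ip x (f n)))\<^sup>2) summable_on I" using sum by (rule has_sum_imp_summable)
    have "(norm x)\<^sup>2 \<le> (c * norm ?u)\<^sup>2" using lower[OF x] by (intro power_mono) auto
    \<comment> \<open>\<open>c\<^sup>2\<close> is increased by \<open>1\<close> because \<open>c\<close> may be \<open>0\<close>\<close>
    also have "\<dots> \<le> (c\<^sup>2 + 1) * (norm ?u)\<^sup>2" by (simp add: power_mult_distrib algebra_simps)
    finally show "1 / (c\<^sup>2 + 1) * (norm x)\<^sup>2 \<le> (\<Sum>\<^sub>\<infinity>n\<in>I. (norm (ip x (f n)))\<^sup>2)"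
      unfolding infsumI[OF sum] by (simp add: field_simps add_pos_nonneg pos_divide_le_eq)
    have "norm ?u \<le> norm (analysis x)"
      by (rule norm_ell2_mono) (simp add: nth_diag_ell2[of "indicator I", OF ind] norm_mult indicator_def)
    then have "norm ?u \<le> K * norm x" using K(2)[of x] by linarith
    then have "(norm ?u)\<^sup>2 \<le> (K * norm x)\<^sup>2" by (rule power_mono) simp
    then show "(\<Sum>\<^sub>\<infinity>n\<in>I. (norm (ip x (f n)))\<^sup>2) \<le> K\<^sup>2 * (norm x)\<^sup>2"
      unfolding infsumI[OF sum] by (simp add: power_mult_distrib)
  qed
  moreover have "0 < 1 / (c\<^sup>2 + 1)" "0 < K\<^sup>2" using K(1) by (auto simp: add_nonneg_pos)
  ultimately show ?thesis using f unfolding riesz_frame_def by blast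
qed

text \<open>Let \<open>y\<close> solve the weighted least squares problem for the coefficients \<open>x\<close>, let \<open>p\<close> be its orthogonal
  projection to \<open>W\<close>, and let \<open>F\<close> be the weighted frame operator, so that the normal equation reads
  \<open>F p = T (?D x)\<close> with the weights on the diagonal of \<open>?D\<close>. The solutions of the truncated problems,
  with the first \<open>N\<close> vectors only, are bounded by \<open>norm x / sqrt a\<close> independently of \<open>N\<close> and of the
  weights. They enter only through inner products with the truncated \<open>F v\<close>, which converge; this gives
  \<open>\<bar>\<langle>p, F v\<rangle>\<bar> \<le> norm x / sqrt a * norm (F v)\<close> for all \<open>v\<close>. As \<open>F\<close> has dense range in \<open>W\<close>, one may put
  \<open>p\<close> for \<open>F v\<close>.\<close>

lemma uniformly_bounded_if_riesz_frame:
  assumes "riesz_frame smul ip f W"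
  obtains c where "\<And>d l K x. 0 < l \<Longrightarrow> (\<And>n. l \<le> d n) \<Longrightarrow> (\<And>n. d n \<le> K) \<Longrightarrow>
    norm (oblique_weighted_pinv d x) \<le> c * norm x"
proof -
  obtain a where a: "0 < a"
    "\<And>I y. y \<in> closed_span smul (f ` I) \<Longrightarrow> a * (norm y)\<^sup>2 \<le> (\<Sum>\<^sub>\<infinity>n\<in>I. (norm (ip y (f n)))\<^sup>2)"
    using assms unfolding riesz_frame_def frame_with_bounds_def by blast
  obtain b where b: "0 < b" "\<And>y. y \<in> W \<Longrightarrow> b * norm y \<le> norm (analysis y)"
    using frame_lower_bound[OF f T] by blast
  obtain \<kappa> where \<kappa>: "0 < \<kappa>"
    "\<And>m p. m \<in> M \<Longrightarrow> p \<in> W \<Longrightarrow> (\<And>w. w \<in> W \<Longrightarrow> ip (m - p) w = 0) \<Longrightarrow> norm m \<le> \<kappa> * norm p"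
    using oblique_projection_bound[OF W M dec] by blast
  have "norm (oblique_weighted_pinv d x) \<le> (\<kappa> / sqrt a) * norm x"
    if d: "0 < l" "\<And>n. l \<le> d n" "\<And>n. d n \<le> K" for d l K x
  proof -
    let ?w = "\<lambda>n. 1 / d n" and ?D = "diag_ell2 (\<lambda>n. 1 / d n) :: 'k ell2 \<Rightarrow> 'k ell2"
    define F where "F = T \<circ> ?D \<circ> analysis"
    define y where "y = oblique_weighted_pinv d x"
    note pos = weight_pos[of l d K, OF d] and wb = weight_bounds(2)[of l d K, OF d]
    have D_op: "bounded_op scale_ell2 scale_ell2 ?D" by (rule diag_ell2_bounded_op) (rule wb)
    have nth_D: "ell2_nth (?D z) n = of_real (1 / d n) * ell2_nth z n" for z n
      by (rule nth_diag_ell2) (rule wb)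
    have F_op: "bounded_op smul smul F"
      unfolding F_def by (intro bounded_op_compose[OF analysis_op] bounded_op_compose[OF D_op] T_op)
    have ip_F: "ip (F u) v = ip_ell2 (inv_root d (analysis u)) (inv_root d (analysis v))" for u v
      by (simp add: F_def syn.adj_eq[OF T_op] inv_root_twice[of l d K, OF d, symmetric] ip_inv_root[of l d K, OF d])
    have F_sym: "ip (F u) v = ip u (F v)" for u v
      by (metis ip_F ip_commute ell2.ip_commute)
    obtain p where p: "p \<in> W" "\<And>w. w \<in> W \<Longrightarrow> ip (y - p) w = 0"
      using orthogonal_projection_exists[OF W, of y] by blast
    have "F p = T (?D x)"
    proof -
      have "analysis p = analysis y" by (rule adj_synthesis_projection[OF T frame_mem[OF f] p(2)])
      then have "T (?D x) - F p = T (?D (x - analysis y))"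
        using linear_simps(2)[OF syn.bounded_op_bounded_linear[OF T_op]]
          linear_simps(2)[OF ell2_pair.bounded_op_bounded_linear[OF D_op]] by (simp add: F_def)
      then show ?thesis using oblique_weighted_pinv_normal_equation[of l d K x, OF d] by (simp add: y_def)
    qed
    have T_lim: "(\<lambda>N. \<Sum>n<N. smul (of_real (1 / d n) * ell2_nth z n) (f n)) \<longlonglongrightarrow> T (?D z)" for z
      using bounded_op_ell2_expansion[OF hilbert_space_axioms T_op, of "?D z"] T
      by (simp add: nth_D synthesis_operator_def del: of_real_divide)
    have F_lim: "(\<lambda>N. weighted_frame_op ?w f {..<N} v) \<longlonglongrightarrow> F v" for v
      using T_lim[of "analysis v"] by (simp add: weighted_frame_op_def nth_analysis F_def del: of_real_divide)
    have key: "norm (ip p (F v)) \<le> norm x / sqrt a * norm (F v)" for v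
    proof (rule LIMSEQ_le)
      let ?b = "\<lambda>N. \<Sum>n<N. smul (of_real (?w n) * ell2_nth x n) (f n)"
      have "(\<lambda>N. norm (ip (?b N) v)) \<longlonglongrightarrow> norm (ip (T (?D x)) v)"
        by (intro tendsto_norm tendsto_ip T_lim tendsto_const)
      then show "(\<lambda>N. norm (ip (?b N) v)) \<longlonglongrightarrow> norm (ip p (F v))"
        using \<open>F p = T (?D x)\<close> F_sym[of p v] by simp
      show "(\<lambda>N. norm x / sqrt a * norm (weighted_frame_op ?w f {..<N} v)) \<longlonglongrightarrow> norm x / sqrt a * norm (F v)"
        by (intro tendsto_intros F_lim)
      have "norm (ip (?b N) v) \<le> norm x / sqrt a * norm (weighted_frame_op ?w f {..<N} v)" for N
      proof -
        have "a * (norm z)\<^sup>2 \<le> (\<Sum>n\<in>J. (norm (ip z (f n)))\<^sup>2)" if "J \<subseteq> {..<N}" "z \<in> span (f ` J)" for J z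
          using a(2)[of z J] that closure_subset[of "span (f ` J)"] finite_subset[OF that(1)]
          by (auto simp: closed_span_def)
        then obtain z where z: "weighted_frame_op ?w f {..<N} z = ?b N"
            "a * (norm z)\<^sup>2 \<le> (\<Sum>n<N. (norm (ell2_nth x n))\<^sup>2)"
          using least_squares_bound[of "{..<N}" ?w a f "ell2_nth x"] pos a(1) by auto
        have "a * (norm z)\<^sup>2 \<le> (norm x)\<^sup>2" using z(2) sum_le_norm_ell2[of "{..<N}" x] by simp
        then have "(sqrt a * norm z)\<^sup>2 \<le> (norm x)\<^sup>2" using a(1) by (simp add: power_mult_distrib)
        then have "sqrt a * norm z \<le> norm x" by (rule power2_le_imp_le) simp
        then have nz: "norm z \<le> norm x / sqrt a" using a(1) by (simp add: field_simps)
        have "ip (?b N) v = ip z (weighted_frame_op ?w f {..<N} v)"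
          unfolding z(1)[symmetric] by (rule ip_weighted_frame_op)
        then show ?thesis
          using order_trans[OF cauchy_schwarz mult_right_mono[OF nz norm_ge_zero]] by simp
      qed
      then show "\<exists>M. \<forall>N\<ge>M. norm (ip (?b N) v) \<le> norm x / sqrt a * norm (weighted_frame_op ?w f {..<N} v)"
        by blast
    qed
    have "W \<subseteq> closure (range F)"
    proof (rule dense_if_no_orthogonal_vector[OF self.range_subspace[OF F_op] W])
      show "range F \<subseteq> W" using T_mem by (auto simp: F_def)
      fix q assume q: "q \<in> W" "\<And>u. u \<in> range F \<Longrightarrow> ip q u = 0"
      have "ip (F q) q = 0" using q(2) ip_eq_0_commute by blast
      then have "inv_root d (analysis q) = 0" by (simp add: ip_F)
      then have "analysis q = 0" using inv_root_lower[of l d K "analysis q", OF d] by simp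
      then show "q = 0" using b(2)[OF q(1)] b(1) by (simp add: mult_le_0_iff)
    qed
    also have "\<dots> \<subseteq> {u. norm (ip p u) \<le> norm x / sqrt a * norm u}"
      using key by (intro closure_minimal closed_Collect_le continuous_intros continuous_on_ip) auto
    finally have "norm (ip p p) \<le> norm x / sqrt a * norm p" using p(1) by blast
    then have "norm p * norm p \<le> norm x / sqrt a * norm p"
      by (simp only: norm_ip_self power2_eq_square)
    then have "norm p \<le> norm x / sqrt a"
      using a(1) by (cases "p = 0") (auto dest: mult_right_le_imp_le simp del: times_divide_eq_left)
    then have "\<kappa> * norm p \<le> \<kappa> * (norm x / sqrt a)" using \<kappa>(1) by (intro mult_left_mono) auto
    moreover have "norm y \<le> \<kappa> * norm p"
      using \<kappa>(2)[OF _ p] oblique_weighted_pinv_mem[of l d K, OF d] by (simp add: y_def)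
    ultimately show ?thesis by (simp add: y_def)
  qed
  then show ?thesis using that by blast
qed

end

text \<open>Every operator in \<open>diag_pos_ops\<close> is given by a sequence \<open>d\<close> bounded above and away from \<open>0\<close>, and
  conversely, so the supremum is finite exactly when the bound is uniform in \<open>d\<close>.\<close>

theorem theorem4p5:
  fixes smul :: "'k::rc_scalar \<Rightarrow> 'h::banach \<Rightarrow> 'h"
    and ip :: "'h \<Rightarrow> 'h \<Rightarrow> 'k"
    and W M :: "'h set"
    and f g :: "nat \<Rightarrow> 'h"
    and T B :: "'k ell2 \<Rightarrow> 'h"
  assumes "hilbert_space smul ip"
    and "separable_space (euclidean :: 'h topology)"
    and "closed_subspace smul W" and "frame ip UNIV f W" and "synthesis_operator smul f T"
    and "closed_subspace smul M"
    and "direct_sum_decomposition W (orthogonal_complement ip M)"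
    and "frame ip UNIV g M" and "synthesis_operator smul g B"
  shows "riesz_frame smul ip f W \<longleftrightarrow>
    (SUP D\<in>diag_pos_ops. ereal (onorm
       (B \<circ> pinv scale_ell2 ip_ell2 scale_ell2 ip_ell2 (inv_sqrt_ell2 D \<circ> adj ip_ell2 ip T \<circ> B)
          \<circ> inv_sqrt_ell2 D))) < \<infinity>"
    (is "_ \<longleftrightarrow> (SUP D\<in>_. ereal (onorm (?G D))) < \<infinity>")
proof -
  interpret oblique_frame_pair smul ip W M f g T B
    using assms by (simp add: oblique_frame_pair_def oblique_frame_pair_axioms_def)
  interpret syn: hilbert_pair scale_ell2 ip_ell2 smul ip ..
  have G: "?G (diag_ell2 d) = oblique_weighted_pinv d"
    if "0 < l" "\<And>n. l \<le> d n" "\<And>n. d n \<le> K" for d l K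
    unfolding oblique_weighted_pinv_def inv_sqrt_diag_ell2[OF that] ..
  show ?thesis
  proof
    assume "riesz_frame smul ip f W"
    then obtain c where c: "\<And>d l K x. 0 < l \<Longrightarrow> (\<And>n. l \<le> d n) \<Longrightarrow> (\<And>n. d n \<le> K) \<Longrightarrow>
        norm (oblique_weighted_pinv d x) \<le> c * norm x"
      using uniformly_bounded_if_riesz_frame by blast
    have "norm (oblique_weighted_pinv (\<lambda>_. 1) (ell2_basis 0)) \<le> c"
      using c[of 1 "\<lambda>_. 1" 1 "ell2_basis 0"] by (simp add: norm_ell2_basis)
    then have c0: "0 \<le> c" using norm_ge_zero order_trans by blast
    have "onorm (?G D) \<le> c" if D: "D \<in> diag_pos_ops" for D
    proof -
      obtain d l K where d: "D = diag_ell2 d" "0 < l" "\<And>n. l \<le> d n" "\<And>n. d n \<le> K"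
        using diag_pos_ops_cases[OF D] by blast
      show ?thesis unfolding d(1) G[OF d(2-4)] using c[OF d(2-4)] by (rule onorm_bound[OF c0])
    qed
    then have "(SUP D\<in>diag_pos_ops. ereal (onorm (?G D))) \<le> ereal c" by (intro SUP_least) simp
    then show "(SUP D\<in>diag_pos_ops. ereal (onorm (?G D))) < \<infinity>" by (rule le_less_trans) simp
  next
    assume "(SUP D\<in>diag_pos_ops. ereal (onorm (?G D))) < \<infinity>"
    from ereal_dense2[OF this] obtain c where
      c: "(SUP D\<in>diag_pos_ops. ereal (onorm (?G D))) < ereal c" by (elim exE conjE)
    show "riesz_frame smul ip f W"
    proof (rule riesz_frame_if_uniformly_bounded)
      fix d :: "nat \<Rightarrow> real" and l K and x :: "'k ell2" assume d: "0 < l" "\<And>n. l \<le> d n" "\<And>n. d n \<le> K"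
      have "ereal (onorm (?G (diag_ell2 d))) \<le> ereal c"
        using SUP_upper[OF diag_ell2_in_diag_pos_ops[OF d]] less_imp_le[OF c] by (rule order_trans)
      then have "onorm (oblique_weighted_pinv d) \<le> c" by (simp add: G[OF d])
      then have "onorm (oblique_weighted_pinv d) * norm x \<le> c * norm x" by (rule mult_right_mono) simp
      moreover have "norm (oblique_weighted_pinv d x) \<le> onorm (oblique_weighted_pinv d) * norm x"
        by (rule onorm[OF syn.bounded_op_bounded_linear[OF oblique_weighted_pinv_op[OF d]]])
      ultimately show "norm (oblique_weighted_pinv d x) \<le> c * norm x" by linarith
    qed
  qed
qed

end
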